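(* Let $\mathfrak O$ be a compact discrete valuation ring with residue field of cardinality $q$. Let $d,e\ge1$, let $\mathcal A$ be a partial colouring of $[d]\times[e]$, and let $u\in \mathrm M_{d\times e}(\mathfrak O)$ have unit entries. If $\mathcal A$ is admissible, then $$\mathsf Z^{\mathsf{ask}}_{\mathrm{Rel}_{d\times e}(\mathcal A,u,\mathfrak O)}(T)=\frac{1-q^{-e}T}{(1-T)(1-q^{d-e}T)}.$$
   Context: All rings are commutative and unital. $\mathfrak O$ has maximal ideal $\mathfrak P$. Write $[d]=\{1,\dots,d\}$. Ask zeta functions. For a module $A\subset \mathrm M_{d\times e}(S)$ of matrices over a finite ring $S$, let $\mathrm{ask}(A)=\frac1{|A|}\sum_{a\in A}|\mathrm{Ker}(a)|$, where $d\times e$ matrices act by right multiplication on row vectors, i.e. $\mathrm{Ker}(a)=\{x\in S^d: xa=0\}$. For a submodule $M\subset \mathrm M_{d\times e}(\mathfrak O)$, let $M_n$ be its image in $\mathrm M_{d\times e}(\mathfrak O/\mathfrak P^n)$ and $\mathsf Z^{\mathsf{ask}}_M(T)=\sum_{n=0}^\infty \mathrm{ask}(M_n)T^n\in\mathbf Q[[T]]$. Partial colourings. Let $\mathcal C$ be a set (of colours). A partial colouring of $[d]\times[e]$ is a family $\mathcal A=(A_c)_{c\in\mathcal C}$ of pairwise disjoint (possibly empty) subsets of $[d]\times[e]$. A cell $(i,j)\in [d]\times[e]$ is blank if it belongs to no $A_c$. A subgrid is a set $G=I\times J$ with $I\subset[d]$, $J\subset[e]$; it is colour-closed if $A_c\subset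 G$ for every $c\in\mathcal C$ with $A_c\cap G\ne\emptyset$. $\mathcal A$ is admissible if every non-empty colour-closed subgrid of $[d]\times[e]$ contains a blank cell. Relation module. $\mathrm{Rel}_{d\times e}(\mathcal A,u,\mathfrak O)=\{[x_{ij}]\in \mathrm M_{d\times e}(\mathfrak O): \sum_{(i,j)\in A_c}u_{ij}x_{ij}=0 \text{ for all } c\in\mathcal C\}$. *)

theory Defs
  imports
    "HOL-Algebra.Ideal_Product"
    "HOL-Algebra.QuotRing"
    "HOL-Algebra.Ring_Divisibility"
    "HOL-Analysis.Abstract_Topology"
    "HOL-Computational_Algebra.Formal_Power_Series"
    "HOL-Library.Disjoint_Sets"
    "HOL-Library.FuncSet"
begin

section \<open>Compact discrete valuation rings\<close>

definition ideal_pow :: "('a, 'm) ring_scheme \<Rightarrow> 'a set \<Rightarrow> nat \<Rightarrow> 'a set" where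
  "ideal_pow R I n = I [^]\<^bsub>ideals_set R\<^esub> n"

definition adic_topology :: "('a, 'm) ring_scheme \<Rightarrow> 'a set \<Rightarrow> 'a topology" where
  "adic_topology R I =
     topology_generated_by {ideal_pow R I n +>\<^bsub>R\<^esub> a |n a. a \<in> carrier R}"

text \<open>A discrete valuation ring is a local principal ideal domain that is not a field;
  \<open>P\<close> is its maximal ideal.\<close>

locale discrete_valuation_ring = principal_domain R for R (structure) +
  fixes P :: "'a set"
  assumes maximal: "maximalideal P R"
    and local: "\<And>Q. maximalideal Q R \<Longrightarrow> Q = P"
    and not_field: "P \<noteq> {\<zero>}"

locale compact_dvr = discrete_valuation_ring +
  assumes compact: "compact_space (adic_topology R P)"


section \<open>Matrices and ask zeta functions\<close>

definition grid :: "nat \<Rightarrow> nat \<Rightarrow> (nat \<times> nat) set" where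
  "grid d e = {1..d} \<times> {1..e}"

text \<open>Vectors and matrices are extensional functions, so that equality is entrywise equality and
  cardinalities of sets of matrices are the intended ones.\<close>

definition vectors :: "('a, 'm) ring_scheme \<Rightarrow> nat \<Rightarrow> (nat \<Rightarrow> 'a) set" where
  "vectors S d = {1..d} \<rightarrow>\<^sub>E carrier S"

definition matrices :: "('a, 'm) ring_scheme \<Rightarrow> nat \<Rightarrow> nat \<Rightarrow> (nat \<times> nat \<Rightarrow> 'a) set" where
  "matrices S d e = grid d e \<rightarrow>\<^sub>E carrier S"

text \<open>Matrices act by right multiplication on row vectors.\<close>

definition Ker ::
  "('a, 'm) ring_scheme \<Rightarrow> nat \<Rightarrow> nat \<Rightarrow> (nat \<times> nat \<Rightarrow> 'a) \<Rightarrow> (nat \<Rightarrow> 'a) set" where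
  "Ker S d e a = {x \<in> vectors S d.
     \<forall>j\<in>{1..e}. (\<Oplus>\<^bsub>S\<^esub>i\<in>{1..d}. x i \<otimes>\<^bsub>S\<^esub> a (i, j)) = \<zero>\<^bsub>S\<^esub>}"

definition ask ::
  "('a, 'm) ring_scheme \<Rightarrow> nat \<Rightarrow> nat \<Rightarrow> (nat \<times> nat \<Rightarrow> 'a) set \<Rightarrow> rat" where
  "ask S d e A = (1 / of_nat (card A)) * (\<Sum>a\<in>A. of_nat (card (Ker S d e a)))"

definition matrices_mod ::
  "('a, 'm) ring_scheme \<Rightarrow> 'a set \<Rightarrow> nat \<Rightarrow> nat \<Rightarrow> (nat \<times> nat \<Rightarrow> 'a) set
    \<Rightarrow> (nat \<times> nat \<Rightarrow> 'a set) set" where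
  "matrices_mod R I d e M = (\<lambda>x. \<lambda>ij\<in>grid d e. I +>\<^bsub>R\<^esub> x ij) ` M"

text \<open>The parameter \<open>P\<close> is the maximal ideal of \<open>R\<close>, and \<open>M\<close> is a submodule of
  \<open>matrices R d e\<close>.\<close>

definition ask_zeta ::
  "('a, 'm) ring_scheme \<Rightarrow> 'a set \<Rightarrow> nat \<Rightarrow> nat \<Rightarrow> (nat \<times> nat \<Rightarrow> 'a) set \<Rightarrow> rat fps" where
  "ask_zeta R P d e M = Abs_fps (\<lambda>n.
     ask (R Quot ideal_pow R P n) d e (matrices_mod R (ideal_pow R P n) d e M))"


section \<open>Partial colourings and relation modules\<close>

definition partial_colouring ::
  "nat \<Rightarrow> nat \<Rightarrow> 'c set \<Rightarrow> ('c \<Rightarrow> (nat \<times> nat) set) \<Rightarrow> bool" where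
  "partial_colouring d e C A \<longleftrightarrow>
     (\<forall>c\<in>C. A c \<subseteq> grid d e) \<and> disjoint_family_on A C"

definition blank ::
  "nat \<Rightarrow> nat \<Rightarrow> 'c set \<Rightarrow> ('c \<Rightarrow> (nat \<times> nat) set) \<Rightarrow> nat \<times> nat \<Rightarrow> bool" where
  "blank d e C A ij \<longleftrightarrow> ij \<in> grid d e \<and> (\<forall>c\<in>C. ij \<notin> A c)"

definition subgrid :: "nat \<Rightarrow> nat \<Rightarrow> (nat \<times> nat) set \<Rightarrow> bool" where
  "subgrid d e G \<longleftrightarrow> (\<exists>I J. I \<subseteq> {1..d} \<and> J \<subseteq> {1..e} \<and> G = I \<times> J)"

definition colour_closed ::
  "'c set \<Rightarrow> ('c \<Rightarrow> (nat \<times> nat) set) \<Rightarrow> (nat \<times> nat) set \<Rightarrow> bool" where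
  "colour_closed C A G \<longleftrightarrow> (\<forall>c\<in>C. A c \<inter> G \<noteq> {} \<longrightarrow> A c \<subseteq> G)"

definition admissible ::
  "nat \<Rightarrow> nat \<Rightarrow> 'c set \<Rightarrow> ('c \<Rightarrow> (nat \<times> nat) set) \<Rightarrow> bool" where
  "admissible d e C A \<longleftrightarrow>
     (\<forall>G. subgrid d e G \<and> G \<noteq> {} \<and> colour_closed C A G \<longrightarrow> (\<exists>ij\<in>G. blank d e C A ij))"

definition Rel ::
  "('a, 'm) ring_scheme \<Rightarrow> nat \<Rightarrow> nat \<Rightarrow> 'c set \<Rightarrow> ('c \<Rightarrow> (nat \<times> nat) set)
    \<Rightarrow> (nat \<times> nat \<Rightarrow> 'a) \<Rightarrow> (nat \<times> nat \<Rightarrow> 'a) set" where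
  "Rel R d e C A u = {x \<in> matrices R d e.
     \<forall>c\<in>C. (\<Oplus>\<^bsub>R\<^esub>ij\<in>A c. u ij \<otimes>\<^bsub>R\<^esub> x ij) = \<zero>\<^bsub>R\<^esub>}"

end

theory Submission
  imports Defs
begin

text \<open>Write \<open>S\<close> for the quotient of \<open>R\<close> by the \<open>n\<close>-th power of \<open>P\<close>, and \<open>M\<close> for the image of the
  relation module over \<open>S\<close>. Counting pairs \<open>(x, a)\<close> with \<open>x a = 0\<close> by \<open>x\<close> instead of \<open>a\<close>, the average kernel size is
  the sum over \<open>x\<close> of the reciprocals of the sizes of the submodules \<open>x M\<close>. If \<open>x = \<pi>\<^sup>k y\<close> with a unit
  among the entries of \<open>y\<close>, admissibility forces \<open>y M\<close> to be everything, so \<open>x M\<close> is as large as for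
  the module of all matrices, and the sum depends only on the number of \<open>x\<close> for each \<open>k\<close>.\<close>

text \<open>Over a local ring it can be tested modulo the maximal ideal whether y M is everything: a
  proper submodule is sent into the maximal ideal by a linear form z with some coefficient outside
  it. Evaluated at y a, this becomes a condition on the products z_j y_i, and the cells where such a
  product is non-zero modulo the maximal ideal form a product of two index sets. That is why
  admissibility speaks of subgrids.

  The argument runs over \<open>S\<close>, which may have zero divisors, with an image M that is not
  given by equations over \<open>S\<close>. It therefore asks only that two kinds of matrices lie in
  M: the matrix unit of each blank cell, and a combination with unit coefficients of the matrix
  units of any two cells of one colour. Both kinds survive reduction, so the image never has to be
  described.

  Compactness enters through the finiteness of the residue field. From there on, only the sizes of
  the ideals of \<open>S\<close> generated by powers of \<pi> and the unit criterion outside \<pi>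
  \<open>S\<close> are used.\<close>

section \<open>Linear forms on proper submodules over a local ring\<close>

text \<open>The hypotheses make the ring local with maximal ideal \<open>I\<close>. This is
  Nakayama's lemma combined with duality over the residue field, but Gaussian elimination produces
  the form directly: either the coordinate form at \<open>b\<close> works, or a vector of
  \<open>N\<close> with a unit at \<open>b\<close> serves as pivot and one coordinate is
  eliminated.\<close>

lemma (in cring) proper_submodule_annihilator:
  assumes I: "ideal I R" "\<one> \<notin> I" and units: "\<And>r. r \<in> carrier R \<Longrightarrow> r \<notin> I \<Longrightarrow> r \<in> Units R"
    and J: "finite J" and N: "N \<subseteq> J \<rightarrow>\<^sub>E carrier R" "N \<noteq> {}" "N \<noteq> (J \<rightarrow>\<^sub>E carrier R)"
    and lin: "\<And>v w c. v \<in> N \<Longrightarrow> w \<in> N \<Longrightarrow> c \<in> carrier R \<Longrightarrow> (\<lambda>j\<in>J. v j \<oplus> c \<otimes> w j) \<in> N"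
  shows "\<exists>z\<in>J \<rightarrow> carrier R. (\<exists>j\<in>J. z j \<notin> I) \<and> (\<forall>v\<in>N. (\<Oplus>j\<in>J. z j \<otimes> v j) \<in> I)"
  using J N lin
proof (induction J arbitrary: N rule: finite_induct)
  case empty
  then show ?case by auto
next
  case (insert b J)
  interpret I: ideal I R by fact
  have car: "v j \<in> carrier R" if "v \<in> N" "j \<in> insert b J" for v j
    using insert.prems(1) that by (auto simp: PiE_iff)
  show ?case
  proof (cases "\<forall>v\<in>N. v b \<in> I")
    case True
    let ?z = "\<lambda>j. if j = b then \<one> else \<zero>"
    have "(\<Oplus>j\<in>insert b J. ?z j \<otimes> v j) \<in> I" if "v \<in> N" for v
    proof -
      have "(\<Oplus>j\<in>J. ?z j \<otimes> v j) = (\<Oplus>j\<in>J. \<zero>)"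
        using insert.hyps car[OF that] by (intro finsum_cong') auto
      moreover have "(\<Oplus>j\<in>insert b J. ?z j \<otimes> v j) = v b \<oplus> (\<Oplus>j\<in>J. ?z j \<otimes> v j)"
        using insert.hyps car[OF that] by (subst finsum_insert) (auto simp: Pi_def)
      ultimately show ?thesis using True that car[OF that, of b] by simp
    qed
    then show ?thesis using I(2) by (intro bexI[of _ ?z]) auto
  next
    case False
    then obtain w where w: "w \<in> N" "w b \<notin> I" by blast
    then have wU: "w b \<in> Units R" using units car by blast
    define t where "t = inv (w b)"
    have t: "t \<in> carrier R" "t \<otimes> w b = \<one>" using wU unfolding t_def by auto
    have wc: "w j \<in> carrier R" if "j \<in> insert b J" for j using car w that by blast
    \<comment> \<open>The part of \<open>N\<close> with vanishing coordinate \<open>b\<close>,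
      viewed in the coordinates \<open>J\<close>. Subtracting (v b) t w moves every \<open>v\<close>
      of \<open>N\<close> there.\<close>
    define N' where "N' = (\<lambda>v. restrict v J) ` {v \<in> N. v b = \<zero>}"
    have sub: "(\<lambda>j\<in>insert b J. v j \<oplus> (\<ominus> (v b \<otimes> t)) \<otimes> w j) \<in> {v \<in> N. v b = \<zero>}" if v: "v \<in> N" for v
    proof -
      have vb: "v b \<in> carrier R" "w b \<in> carrier R" using car v wc by auto
      have "v b \<oplus> (\<ominus> (v b \<otimes> t)) \<otimes> w b = v b \<ominus> v b \<otimes> (t \<otimes> w b)"
        using vb t(1) by algebra
      also have "\<dots> = \<zero>" using vb t by (simp add: r_neg minus_eq)
      finally have "v b \<oplus> (\<ominus> (v b \<otimes> t)) \<otimes> w b = \<zero>" .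
      moreover have "(\<lambda>j\<in>insert b J. v j \<oplus> (\<ominus> (v b \<otimes> t)) \<otimes> w j) \<in> N"
        using vb t by (intro insert.prems(4)[OF v w(1)]) auto
      ultimately show ?thesis by simp
    qed
    have "N' \<subseteq> J \<rightarrow>\<^sub>E carrier R" using car unfolding N'_def by auto
    moreover have "N' \<noteq> {}" using sub[OF w(1)] unfolding N'_def by blast
    moreover have "N' \<noteq> (J \<rightarrow>\<^sub>E carrier R)"
    proof
      assume full: "N' = (J \<rightarrow>\<^sub>E carrier R)"
      \<comment> \<open>If \<open>N'\<close> were everything, so would \<open>N\<close> be:
        subtracting c w clears the coordinate \<open>b\<close> of \<open>y\<close>, the remainder
        lifts to \<open>N\<close>, and c w is added back.\<close>
      have "y \<in> N" if y: "y \<in> insert b J \<rightarrow>\<^sub>E carrier R" for y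
      proof -
        define c where "c = y b \<otimes> t"
        have yc: "y j \<in> carrier R" if "j \<in> insert b J" for j using y that by (auto simp: PiE_iff)
        have c: "c \<in> carrier R" "c \<otimes> w b = y b"
          using yc[of b] t wc[of b] unfolding c_def by (auto simp: m_assoc)
        have "(\<lambda>j\<in>J. y j \<ominus> c \<otimes> w j) \<in> N'" unfolding full using yc wc c by auto
        then obtain v where v: "v \<in> N" "v b = \<zero>" "restrict v J = (\<lambda>j\<in>J. y j \<ominus> c \<otimes> w j)"
          unfolding N'_def by auto
        have vj: "v j = y j \<ominus> c \<otimes> w j" if "j \<in> J" for j using fun_cong[OF v(3), of j] that by simp
        have "(\<lambda>j\<in>insert b J. v j \<oplus> c \<otimes> w j) = y"
        proof
          fix j
          show "(\<lambda>j\<in>insert b J. v j \<oplus> c \<otimes> w j) j = y j"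
          proof (cases "j \<in> insert b J")
            case True
            then consider "j = b" | "j \<in> J" by blast
            then show ?thesis
            proof cases
              case 1
              then show ?thesis using v(2) c yc[of b] by simp
            next
              case 2
              have "y j \<ominus> c \<otimes> w j \<oplus> c \<otimes> w j = y j"
                using yc[of j] c(1) wc[of j] 2 by (simp add: minus_eq a_assoc l_neg)
              then show ?thesis using 2 vj by simp
            qed
          next
            case False
            then show ?thesis using y by (auto simp: PiE_iff extensional_def)
          qed
        qed
        then show ?thesis using insert.prems(4)[OF v(1) w(1) c(1)] by simp
      qed
      then show False using insert.prems(1,3) by blast
    qed
    moreover have "(\<lambda>j\<in>J. v j \<oplus> c \<otimes> v' j) \<in> N'"
      if vN: "v \<in> N'" "v' \<in> N'" and c: "c \<in> carrier R" for v v' c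
    proof -
      obtain y where y: "y \<in> N" "y b = \<zero>" "v = restrict y J" using vN unfolding N'_def by auto
      obtain y' where y': "y' \<in> N" "y' b = \<zero>" "v' = restrict y' J" using vN unfolding N'_def by auto
      let ?s = "\<lambda>j\<in>insert b J. y j \<oplus> c \<otimes> y' j"
      have "?s \<in> N" by (rule insert.prems(4)[OF y(1) y'(1) c])
      moreover have "?s b = \<zero>" using y y' c by simp
      moreover have "(\<lambda>j\<in>J. v j \<oplus> c \<otimes> v' j) = restrict ?s J"
        using y y' by (auto simp: restrict_def)
      ultimately show ?thesis unfolding N'_def by blast
    qed
    ultimately obtain z where z: "z \<in> J \<rightarrow> carrier R" "\<exists>j\<in>J. z j \<notin> I"
      "\<And>v. v \<in> N' \<Longrightarrow> (\<Oplus>j\<in>J. z j \<otimes> v j) \<in> I" using insert.IH[of N'] by blast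
    define s where "s = (\<Oplus>j\<in>J. z j \<otimes> w j)"
    have s: "s \<in> carrier R" unfolding s_def using z wc by (intro finsum_closed) auto
    \<comment> \<open>This coefficient makes the extended form kill the pivot: its value at
      \<open>w\<close> is s - t s (w b) = 0. Its value at \<open>v\<close> is therefore that of
      \<open>z\<close> at v - (v b) t w, which restricts to an element of \<open>N'\<close>.\<close>
    let ?z = "z(b := \<ominus> (t \<otimes> s))"
    have "(\<Oplus>j\<in>insert b J. ?z j \<otimes> v j) \<in> I" if v: "v \<in> N" for v
    proof -
      define c where "c = v b \<otimes> t"
      have vc: "v j \<in> carrier R" if "j \<in> insert b J" for j using car[OF v that] .
      have c: "c \<in> carrier R" using vc t unfolding c_def by auto
      have zc: "z j \<in> carrier R" if "j \<in> J" for j using z(1) that by blast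
      have zv: "(\<lambda>j. z j \<otimes> v j) \<in> J \<rightarrow> carrier R" using zc vc by auto
      have cl: "(\<Oplus>j\<in>J. z j \<otimes> v j) \<in> carrier R" using zv by (rule finsum_closed)
      have "restrict (\<lambda>j\<in>insert b J. v j \<oplus> (\<ominus> c) \<otimes> w j) J \<in> N'"
        using sub[OF v] unfolding N'_def c_def by blast
      then have "(\<Oplus>j\<in>J. z j \<otimes> restrict (\<lambda>j\<in>insert b J. v j \<oplus> (\<ominus> c) \<otimes> w j) J j) \<in> I" by (rule z)
      also have "(\<Oplus>j\<in>J. z j \<otimes> restrict (\<lambda>j\<in>insert b J. v j \<oplus> (\<ominus> c) \<otimes> w j) J j)
          = (\<Oplus>j\<in>J. z j \<otimes> v j \<oplus> (\<ominus> c) \<otimes> (z j \<otimes> w j))"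
      proof (rule finsum_cong')
        fix j assume "j \<in> J"
        then have "z j \<in> carrier R" "v j \<in> carrier R" "w j \<in> carrier R" using zc vc wc by auto
        then have "z j \<otimes> (v j \<oplus> (\<ominus> c) \<otimes> w j) = z j \<otimes> v j \<oplus> (\<ominus> c) \<otimes> (z j \<otimes> w j)"
          using c by algebra
        then show "z j \<otimes> restrict (\<lambda>j\<in>insert b J. v j \<oplus> (\<ominus> c) \<otimes> w j) J j
            = z j \<otimes> v j \<oplus> (\<ominus> c) \<otimes> (z j \<otimes> w j)" using \<open>j \<in> J\<close> by simp
      qed (use zc vc wc c in auto)
      also have "\<dots> = (\<Oplus>j\<in>J. z j \<otimes> v j) \<oplus> (\<Oplus>j\<in>J. (\<ominus> c) \<otimes> (z j \<otimes> w j))"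
        using zc vc wc c by (intro finsum_addf) auto
      also have "(\<Oplus>j\<in>J. (\<ominus> c) \<otimes> (z j \<otimes> w j)) = (\<ominus> c) \<otimes> s"
        unfolding s_def using zc wc c insert.hyps by (intro finsum_rdistr[symmetric]) auto
      also have "(\<Oplus>j\<in>J. z j \<otimes> v j) \<oplus> (\<ominus> c) \<otimes> s = (\<ominus> (t \<otimes> s)) \<otimes> v b \<oplus> (\<Oplus>j\<in>J. z j \<otimes> v j)"
      proof -
        have "r \<oplus> (\<ominus> (v b \<otimes> t)) \<otimes> s = (\<ominus> (t \<otimes> s)) \<otimes> v b \<oplus> r" if "r \<in> carrier R" for r
          using that s t(1) vc[OF insertI1] by algebra
        then show ?thesis using cl unfolding c_def .
      qed
      also have "\<dots> = ?z b \<otimes> v b \<oplus> (\<Oplus>j\<in>J. ?z j \<otimes> v j)"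
      proof -
        have "(\<Oplus>j\<in>J. z j \<otimes> v j) = (\<Oplus>j\<in>J. ?z j \<otimes> v j)"
          using zv insert.hyps by (intro finsum_cong') auto
        then show ?thesis by simp
      qed
      also have "\<dots> = (\<Oplus>j\<in>insert b J. ?z j \<otimes> v j)"
        using insert.hyps zc vc s t by (intro finsum_insert[symmetric]) (auto simp: Pi_def)
      finally show ?thesis .
    qed
    moreover have "?z \<in> insert b J \<rightarrow> carrier R" using z s t by auto
    moreover have "\<exists>j\<in>insert b J. ?z j \<notin> I" using z(2) insert.hyps(2) by auto
    ultimately show ?thesis by blast
  qed
qed

section \<open>Row vectors times matrices\<close>

definition vec_mat ::
  "('a, 'm) ring_scheme \<Rightarrow> nat \<Rightarrow> nat \<Rightarrow> (nat \<Rightarrow> 'a) \<Rightarrow> (nat \<times> nat \<Rightarrow> 'a) \<Rightarrow> nat \<Rightarrow> 'a" where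
  "vec_mat R d e x a = (\<lambda>j\<in>{1..e}. \<Oplus>\<^bsub>R\<^esub>i\<in>{1..d}. x i \<otimes>\<^bsub>R\<^esub> a (i, j))"

text \<open>The scalar x a z^T: the linear form with coefficients \<open>z\<close>, evaluated at the
  row vector x a.\<close>

definition bilin ::
  "('a, 'm) ring_scheme \<Rightarrow> nat \<Rightarrow> nat \<Rightarrow> (nat \<Rightarrow> 'a) \<Rightarrow> (nat \<times> nat \<Rightarrow> 'a) \<Rightarrow> (nat \<Rightarrow> 'a) \<Rightarrow> 'a" where
  "bilin R d e x a z = (\<Oplus>\<^bsub>R\<^esub>j\<in>{1..e}. z j \<otimes>\<^bsub>R\<^esub> (\<Oplus>\<^bsub>R\<^esub>i\<in>{1..d}. x i \<otimes>\<^bsub>R\<^esub> a (i, j)))"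

text \<open>One operation covers what is needed of a module: the scalars 1 and -1 give translations,
  and starting from the zero matrix gives scalar multiples.\<close>

definition mat_lin ::
  "('a, 'm) ring_scheme \<Rightarrow> nat \<Rightarrow> nat \<Rightarrow> (nat \<times> nat \<Rightarrow> 'a) \<Rightarrow> 'a \<Rightarrow> (nat \<times> nat \<Rightarrow> 'a) \<Rightarrow> nat \<times> nat \<Rightarrow> 'a" where
  "mat_lin R d e a c b = (\<lambda>ij\<in>grid d e. a ij \<oplus>\<^bsub>R\<^esub> c \<otimes>\<^bsub>R\<^esub> b ij)"

definition mat_unit ::
  "('a, 'm) ring_scheme \<Rightarrow> nat \<Rightarrow> nat \<Rightarrow> nat \<times> nat \<Rightarrow> nat \<times> nat \<Rightarrow> 'a" where
  "mat_unit R d e p = (\<lambda>ij\<in>grid d e. if ij = p then \<one>\<^bsub>R\<^esub> else \<zero>\<^bsub>R\<^esub>)"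

text \<open>Non-emptiness and closure under a + c b suffice for a submodule: b = a and c = -1 yield
  the zero matrix.\<close>

definition mat_submodule ::
  "('a, 'm) ring_scheme \<Rightarrow> nat \<Rightarrow> nat \<Rightarrow> (nat \<times> nat \<Rightarrow> 'a) set \<Rightarrow> bool" where
  "mat_submodule R d e M \<longleftrightarrow> M \<subseteq> matrices R d e \<and> M \<noteq> {} \<and>
     (\<forall>a\<in>M. \<forall>b\<in>M. \<forall>c\<in>carrier R. mat_lin R d e a c b \<in> M)"

definition mat_scale ::
  "('a, 'm) ring_scheme \<Rightarrow> nat \<Rightarrow> nat \<Rightarrow> 'a \<Rightarrow> (nat \<times> nat \<Rightarrow> 'a) \<Rightarrow> nat \<times> nat \<Rightarrow> 'a" where
  "mat_scale R d e c a = (\<lambda>ij\<in>grid d e. c \<otimes>\<^bsub>R\<^esub> a ij)"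

lemma grid_iff [simp]: "(i, j) \<in> grid d e \<longleftrightarrow> i \<in> {1..d} \<and> j \<in> {1..e}"
  by (auto simp: grid_def)

lemma finite_grid [simp]: "finite (grid d e)"
  by (simp add: grid_def)

lemma matrices_entry: "a \<in> matrices R d e \<Longrightarrow> ij \<in> grid d e \<Longrightarrow> a ij \<in> carrier R"
  by (auto simp: matrices_def)

lemma vectors_entry: "x \<in> vectors R d \<Longrightarrow> i \<in> {1..d} \<Longrightarrow> x i \<in> carrier R"
  by (auto simp: vectors_def)

context cring
begin

lemma mat_lin_closed:
  "a \<in> matrices R d e \<Longrightarrow> b \<in> matrices R d e \<Longrightarrow> c \<in> carrier R \<Longrightarrow> mat_lin R d e a c b \<in> matrices R d e"
  by (auto simp: mat_lin_def matrices_def)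

lemma mat_unit_closed: "mat_unit R d e p \<in> matrices R d e"
  by (auto simp: mat_unit_def matrices_def)

lemma mat_scale_closed: "a \<in> matrices R d e \<Longrightarrow> c \<in> carrier R \<Longrightarrow> mat_scale R d e c a \<in> matrices R d e"
  by (auto simp: mat_scale_def matrices_def)

lemma vec_mat_closed:
  assumes "x \<in> vectors R d" "a \<in> matrices R d e"
  shows "vec_mat R d e x a \<in> vectors R e"
proof -
  have "(\<Oplus>i\<in>{1..d}. x i \<otimes> a (i, j)) \<in> carrier R" if "j \<in> {1..e}" for j
    using that vectors_entry[OF assms(1)] matrices_entry[OF assms(2)] by (intro finsum_closed) auto
  then show ?thesis unfolding vec_mat_def vectors_def by auto
qed

lemma vec_mat_lin:
  assumes "x \<in> vectors R d" "a \<in> matrices R d e" "b \<in> matrices R d e" "c \<in> carrier R"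
  shows "vec_mat R d e x (mat_lin R d e a c b)
    = (\<lambda>j\<in>{1..e}. vec_mat R d e x a j \<oplus> c \<otimes> vec_mat R d e x b j)"
proof
  fix j
  show "vec_mat R d e x (mat_lin R d e a c b) j
    = (\<lambda>j\<in>{1..e}. vec_mat R d e x a j \<oplus> c \<otimes> vec_mat R d e x b j) j"
  proof (cases "j \<in> {1..e}")
    case True
    have car: "x i \<in> carrier R" "a (i, j) \<in> carrier R" "b (i, j) \<in> carrier R" if "i \<in> {1..d}" for i
      using that True vectors_entry[OF assms(1)] matrices_entry[OF assms(2)] matrices_entry[OF assms(3)] by auto
    have "(\<Oplus>i\<in>{1..d}. x i \<otimes> mat_lin R d e a c b (i, j))
        = (\<Oplus>i\<in>{1..d}. x i \<otimes> a (i, j) \<oplus> c \<otimes> (x i \<otimes> b (i, j)))"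
    proof (rule finsum_cong')
      fix i assume i: "i \<in> {1..d}"
      have "x i \<otimes> (a (i, j) \<oplus> c \<otimes> b (i, j)) = x i \<otimes> a (i, j) \<oplus> c \<otimes> (x i \<otimes> b (i, j))"
        using car[OF i] assms(4) by algebra
      then show "x i \<otimes> mat_lin R d e a c b (i, j) = x i \<otimes> a (i, j) \<oplus> c \<otimes> (x i \<otimes> b (i, j))"
        using i True by (simp add: mat_lin_def)
    qed (use car assms in auto)
    also have "\<dots> = (\<Oplus>i\<in>{1..d}. x i \<otimes> a (i, j)) \<oplus> (\<Oplus>i\<in>{1..d}. c \<otimes> (x i \<otimes> b (i, j)))"
      using car assms by (intro finsum_addf) auto
    also have "(\<Oplus>i\<in>{1..d}. c \<otimes> (x i \<otimes> b (i, j))) = c \<otimes> (\<Oplus>i\<in>{1..d}. x i \<otimes> b (i, j))"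
      using car assms by (intro finsum_rdistr[symmetric]) auto
    finally show ?thesis using True by (simp add: vec_mat_def)
  qed (auto simp: vec_mat_def)
qed

lemma bilin_eq: 
  assumes "x \<in> vectors R d" "a \<in> matrices R d e" "z \<in> {1..e} \<rightarrow> carrier R"
  shows "bilin R d e x a z = (\<Oplus>j\<in>{1..e}. z j \<otimes> vec_mat R d e x a j)"
proof -
  have "(\<Oplus>i\<in>{1..d}. x i \<otimes> a (i, j)) \<in> carrier R" if "j \<in> {1..e}" for j
    using that vectors_entry[OF assms(1)] matrices_entry[OF assms(2)] by (intro finsum_closed) auto
  then show ?thesis
    unfolding bilin_def using assms by (intro finsum_cong') (auto simp: vec_mat_def)
qed

lemma bilin_lin:
  assumes "x \<in> vectors R d" "a \<in> matrices R d e" "b \<in> matrices R d e" "c \<in> carrier R"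
    and z: "z \<in> {1..e} \<rightarrow> carrier R"
  shows "bilin R d e x (mat_lin R d e a c b) z = bilin R d e x a z \<oplus> c \<otimes> bilin R d e x b z"
proof -
  have car: "z j \<in> carrier R" "vec_mat R d e x a j \<in> carrier R" "vec_mat R d e x b j \<in> carrier R"
    if "j \<in> {1..e}" for j
    using that z vectors_entry[OF vec_mat_closed[OF assms(1,2)]] vectors_entry[OF vec_mat_closed[OF assms(1,3)]] by auto
  have "bilin R d e x (mat_lin R d e a c b) z
      = (\<Oplus>j\<in>{1..e}. z j \<otimes> vec_mat R d e x (mat_lin R d e a c b) j)"
    using assms by (intro bilin_eq mat_lin_closed) auto
  also have "\<dots> = (\<Oplus>j\<in>{1..e}. z j \<otimes> vec_mat R d e x a j \<oplus> c \<otimes> (z j \<otimes> vec_mat R d e x b j))"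
  proof (rule finsum_cong')
    fix j assume j: "j \<in> {1..e}"
    have "z j \<otimes> (vec_mat R d e x a j \<oplus> c \<otimes> vec_mat R d e x b j)
        = z j \<otimes> vec_mat R d e x a j \<oplus> c \<otimes> (z j \<otimes> vec_mat R d e x b j)"
      using car[OF j] assms(4) by algebra
    then show "z j \<otimes> vec_mat R d e x (mat_lin R d e a c b) j
        = z j \<otimes> vec_mat R d e x a j \<oplus> c \<otimes> (z j \<otimes> vec_mat R d e x b j)"
      using j assms by (simp add: vec_mat_lin)
  qed (use car assms in auto)
  also have "\<dots> = (\<Oplus>j\<in>{1..e}. z j \<otimes> vec_mat R d e x a j) \<oplus> (\<Oplus>j\<in>{1..e}. c \<otimes> (z j \<otimes> vec_mat R d e x b j))"
    using car assms by (intro finsum_addf) auto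
  also have "(\<Oplus>j\<in>{1..e}. c \<otimes> (z j \<otimes> vec_mat R d e x b j)) = c \<otimes> (\<Oplus>j\<in>{1..e}. z j \<otimes> vec_mat R d e x b j)"
    using car assms by (intro finsum_rdistr[symmetric]) auto
  finally show ?thesis using assms by (simp add: bilin_eq)
qed

lemma finsum_delta:
  assumes "finite A" "k \<in> A" "f k \<in> carrier R" "\<And>i. i \<in> A \<Longrightarrow> i \<noteq> k \<Longrightarrow> f i = \<zero>"
  shows "(\<Oplus>i\<in>A. f i) = f k"
proof -
  have "(\<Oplus>i\<in>A. f i) = (\<Oplus>i\<in>A. if k = i then f i else \<zero>)"
    using assms(3,4) by (intro finsum_cong') (auto simp: Pi_def)
  also have "\<dots> = f k"
    using assms by (intro add.finprod_singleton) (auto simp: Pi_def, metis zero_closed)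
  finally show ?thesis .
qed

text \<open>Matrix units pick out the entries of the rank one matrix formed from \<open>z\<close>
  and \<open>x\<close>; this is how a linear form becomes a pattern of cells.\<close>

lemma bilin_mat_unit:
  assumes x: "x \<in> vectors R d" and z: "z \<in> {1..e} \<rightarrow> carrier R" and p: "(k, l) \<in> grid d e"
  shows "bilin R d e x (mat_unit R d e (k, l)) z = z l \<otimes> x k"
proof -
  have kl: "k \<in> {1..d}" "l \<in> {1..e}" using p by auto
  have xc: "x i \<in> carrier R" if "i \<in> {1..d}" for i using x that by (rule vectors_entry)
  have zc: "z j \<in> carrier R" if "j \<in> {1..e}" for j using z that by blast
  have inner: "(\<Oplus>i\<in>{1..d}. x i \<otimes> mat_unit R d e (k, l) (i, j)) = (if j = l then x k else \<zero>)"
    if j: "j \<in> {1..e}" for j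
  proof -
    have eq: "x i \<otimes> mat_unit R d e (k, l) (i, j) = (if i = k \<and> j = l then x i else \<zero>)"
      if "i \<in> {1..d}" for i
      using xc[OF that] that j by (auto simp: mat_unit_def)
    have "(\<Oplus>i\<in>{1..d}. x i \<otimes> mat_unit R d e (k, l) (i, j)) = x k \<otimes> mat_unit R d e (k, l) (k, j)"
      using kl eq xc by (intro finsum_delta) auto
    then show ?thesis using eq kl by simp
  qed
  have "bilin R d e x (mat_unit R d e (k, l)) z
      = z l \<otimes> (\<Oplus>i\<in>{1..d}. x i \<otimes> mat_unit R d e (k, l) (i, l))"
    unfolding bilin_def using kl inner xc zc by (intro finsum_delta) auto
  then show ?thesis using inner kl by simp
qed

lemma bilin_scale:
  assumes x: "x \<in> vectors R d" "a \<in> matrices R d e" "c \<in> carrier R" "z \<in> {1..e} \<rightarrow> carrier R"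
  shows "bilin R d e x (mat_scale R d e c a) z = c \<otimes> bilin R d e x a z"
proof -
  \<comment> \<open>A scalar multiple is \<open>mat_lin\<close> started at the zero matrix, so
    linearity applies.\<close>
  define N where "N = (\<lambda>ij\<in>grid d e. \<zero>)"
  have N: "N \<in> matrices R d e" "\<And>ij. ij \<in> grid d e \<Longrightarrow> N ij = \<zero>"
    by (auto simp: matrices_def N_def)
  have eq: "mat_scale R d e c a = mat_lin R d e N c a"
    unfolding mat_scale_def mat_lin_def using assms by (intro restrict_ext) (simp add: N matrices_entry)
  have "(\<Oplus>i\<in>{1..d}. x i \<otimes> N (i, j)) = \<zero>" if j: "j \<in> {1..e}" for j
  proof -
    have "(\<Oplus>i\<in>{1..d}. x i \<otimes> N (i, j)) = (\<Oplus>i\<in>{1..d}. \<zero>)"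
      using vectors_entry[OF x(1)] j N(2) by (intro finsum_cong') auto
    then show ?thesis by simp
  qed
  then have "bilin R d e x N z = (\<Oplus>j\<in>{1..e}. \<zero>)"
    unfolding bilin_def using assms(4) by (intro finsum_cong') (auto simp: Pi_def)
  moreover have "bilin R d e x a z \<in> carrier R"
    unfolding bilin_eq[OF x(1,2,4)] using x(4) vectors_entry[OF vec_mat_closed[OF x(1,2)]]
    by (intro finsum_closed) auto
  ultimately show ?thesis unfolding eq using assms N by (simp add: bilin_lin)
qed

text \<open>A linear form annihilating the proper submodule \<open>x M\<close> modulo \<open>I\<close> would give a rank one matrix
  whose support modulo \<open>I\<close> is a non-empty colour-closed subgrid without blank cells.\<close>

lemma vec_mat_surj:
  assumes I: "ideal I R" and units: "\<And>r. r \<in> carrier R \<Longrightarrow> r \<notin> I \<Longrightarrow> r \<in> Units R"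
    and M: "mat_submodule R d e M"
    and adm: "admissible d e C A" and col: "\<And>c. c \<in> C \<Longrightarrow> A c \<subseteq> grid d e"
    and blank: "\<And>p. blank d e C A p \<Longrightarrow> mat_unit R d e p \<in> M"
    and pair: "\<And>c p p'. c \<in> C \<Longrightarrow> p \<in> A c \<Longrightarrow> p' \<in> A c \<Longrightarrow> p \<noteq> p' \<Longrightarrow>
      \<exists>\<alpha>\<in>Units R. \<exists>\<beta>\<in>Units R. mat_lin R d e (mat_scale R d e \<alpha> (mat_unit R d e p)) \<beta> (mat_unit R d e p') \<in> M"
    and x: "x \<in> vectors R d" and k: "k \<in> {1..d}" "x k \<notin> I"
  shows "vec_mat R d e x ` M = vectors R e"
proof (rule ccontr)
  interpret I: ideal I R by fact
  have "x k \<in> carrier R" using x k(1) by (rule vectors_entry)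
  \<comment> \<open>Properness of \<open>I\<close> comes from the entry \<open>x k\<close> outside
    it, so the zero ring is excluded here without a separate hypothesis.\<close>
  then have one: "\<one> \<notin> I" using k(2) I.one_imp_carrier by blast
  let ?N = "vec_mat R d e x ` M"
  assume ne: "?N \<noteq> vectors R e"
  have Mm: "a \<in> M \<Longrightarrow> a \<in> matrices R d e" for a using M by (auto simp: mat_submodule_def)
  have lin: "(\<lambda>j\<in>{1..e}. v j \<oplus> c \<otimes> w j) \<in> ?N" if v: "v \<in> ?N" and w: "w \<in> ?N" and c: "c \<in> carrier R" for v w c
  proof -
    obtain a b where ab: "a \<in> M" "b \<in> M" "v = vec_mat R d e x a" "w = vec_mat R d e x b"
      using v w by blast
    have "mat_lin R d e a c b \<in> M" using M ab c by (auto simp: mat_submodule_def)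
    then have "vec_mat R d e x (mat_lin R d e a c b) \<in> ?N" by blast
    then show ?thesis using ab vec_mat_lin[OF x Mm[OF ab(1)] Mm[OF ab(2)] c] by simp
  qed
  have N: "?N \<subseteq> {1..e} \<rightarrow>\<^sub>E carrier R" "?N \<noteq> {}"
    using vec_mat_closed[OF x Mm] M unfolding vectors_def mat_submodule_def by blast+
  have "\<exists>z\<in>{1..e} \<rightarrow> carrier R. (\<exists>j\<in>{1..e}. z j \<notin> I) \<and> (\<forall>v\<in>?N. (\<Oplus>j\<in>{1..e}. z j \<otimes> v j) \<in> I)"
  proof (rule proper_submodule_annihilator[OF I one])
    show "?N \<noteq> ({1..e} \<rightarrow>\<^sub>E carrier R)" using ne unfolding vectors_def .
    show "r \<in> Units R" if "r \<in> carrier R" "r \<notin> I" for r using that by (rule units)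
    show "(\<lambda>j\<in>{1..e}. v j \<oplus> c \<otimes> w j) \<in> ?N" if "v \<in> ?N" "w \<in> ?N" "c \<in> carrier R" for v w c
      using that by (rule lin)
  qed (use N in simp_all)
  then obtain z l where z: "z \<in> {1..e} \<rightarrow> carrier R" and l: "l \<in> {1..e}" "z l \<notin> I"
    and ann: "\<And>v. v \<in> ?N \<Longrightarrow> (\<Oplus>j\<in>{1..e}. z j \<otimes> v j) \<in> I" by blast
  have ann: "bilin R d e x a z \<in> I" if "a \<in> M" for a
    using ann[of "vec_mat R d e x a"] that bilin_eq[OF x Mm z] by auto
  have xc: "x i \<in> carrier R" if "i \<in> {1..d}" for i using x that by (rule vectors_entry)
  have zc: "z j \<in> carrier R" if "j \<in> {1..e}" for j using z that by blast
  have unit_notin: "r \<notin> I" if "r \<in> Units R" for r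
    using that one I.I_l_closed[of r "inv r"] Units_l_inv[of r] by auto
  \<comment> \<open>If both factors were outside \<open>I\<close>, they would be units, and so would
    their product, but no unit lies in \<open>I\<close>.\<close>
  have prime: "r \<in> I \<or> s \<in> I" if rs: "r \<otimes> s \<in> I" and c: "r \<in> carrier R" "s \<in> carrier R" for r s
    using unit_notin[of "r \<otimes> s"] units rs c Units_m_closed by blast
  have primeD: "s \<in> I" if "r \<in> Units R" "s \<in> carrier R" "r \<otimes> s \<in> I" for r s
    using prime[of r s] that unit_notin[of r] by auto
  define G where "G = {i \<in> {1..d}. x i \<notin> I} \<times> {j \<in> {1..e}. z j \<notin> I}"
  \<comment> \<open>Primality of \<open>I\<close> is what turns the support of the rank one matrix
    modulo \<open>I\<close> into a product set.\<close>
  have G: "(i, j) \<in> G \<longleftrightarrow> (i, j) \<in> grid d e \<and> z j \<otimes> x i \<notin> I" for i j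
  proof (cases "(i, j) \<in> grid d e")
    case True
    then have "x i \<in> carrier R" "z j \<in> carrier R" using xc zc by auto
    then have "z j \<otimes> x i \<in> I \<longleftrightarrow> z j \<in> I \<or> x i \<in> I"
      using prime[of "z j" "x i"] I.I_l_closed[of "x i" "z j"] I.I_r_closed[of "z j" "x i"] by blast
    then show ?thesis using True unfolding G_def by auto
  qed (auto simp: G_def)
  have "(k, l) \<in> G" using k l by (simp add: G_def)
  moreover have "subgrid d e G"
    unfolding subgrid_def G_def by (intro exI conjI) (rule Collect_restrict Collect_subset refl)+
  moreover have "colour_closed C A G"
    unfolding colour_closed_def
  proof (intro ballI impI subsetI)
    fix c p' assume c: "c \<in> C" and ne: "A c \<inter> G \<noteq> {}" and p': "p' \<in> A c"
    obtain p where p: "p \<in> A c" "p \<in> G" using ne by blast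
    show "p' \<in> G"
    proof (rule ccontr)
      \<comment> \<open>The form takes the value \<alpha> z_j x_i + \<beta> z_j' x_i' in
        \<open>I\<close> on the matrix attached to the pair. If the product at \<open>p'\<close>
        lies in \<open>I\<close>, then so does the one at \<open>p\<close>, since \<alpha> is a
        unit.\<close>
      assume n: "p' \<notin> G"
      then have "p \<noteq> p'" using p by blast
      then obtain \<alpha> \<beta> where ab: "\<alpha> \<in> Units R" "\<beta> \<in> Units R"
        "mat_lin R d e (mat_scale R d e \<alpha> (mat_unit R d e p)) \<beta> (mat_unit R d e p') \<in> M"
        using pair[OF c p(1) p'] by blast
      obtain i j i' j' where ij: "p = (i, j)" "p' = (i', j')" by fastforce
      have gr: "(i, j) \<in> grid d e" "(i', j') \<in> grid d e" using col[OF c] p p' ij by auto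
      have car: "z j \<otimes> x i \<in> carrier R" "z j' \<otimes> x i' \<in> carrier R" "\<alpha> \<in> carrier R" "\<beta> \<in> carrier R"
        using gr xc zc ab by auto
      have "bilin R d e x (mat_lin R d e (mat_scale R d e \<alpha> (mat_unit R d e p)) \<beta> (mat_unit R d e p')) z
          = \<alpha> \<otimes> (z j \<otimes> x i) \<oplus> \<beta> \<otimes> (z j' \<otimes> x i')"
        using x z car gr unfolding ij
        by (simp add: bilin_lin bilin_scale bilin_mat_unit mat_unit_closed mat_scale_closed del: grid_iff)
      then have s: "\<alpha> \<otimes> (z j \<otimes> x i) \<oplus> \<beta> \<otimes> (z j' \<otimes> x i') \<in> I" using ann[OF ab(3)] by simp
      have "z j' \<otimes> x i' \<in> I" using n gr ij G by blast
      then have t: "\<beta> \<otimes> (z j' \<otimes> x i') \<in> I" using car I.I_l_closed by blast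
      have "\<alpha> \<otimes> (z j \<otimes> x i) = (\<alpha> \<otimes> (z j \<otimes> x i) \<oplus> \<beta> \<otimes> (z j' \<otimes> x i')) \<ominus> \<beta> \<otimes> (z j' \<otimes> x i')"
        using car by algebra
      also have "\<dots> \<in> I" using s t by (simp add: minus_eq)
      finally have "z j \<otimes> x i \<in> I" using primeD ab car by blast
      then show False using p ij G by blast
    qed
  qed
  ultimately obtain p where p: "p \<in> G" "blank d e C A p"
    using adm unfolding admissible_def by blast
  obtain i j where ij: "p = (i, j)" by fastforce
  \<comment> \<open>At a blank cell the matrix unit itself lies in \<open>M\<close>, which forces
    the product there into \<open>I\<close>, although the cell belongs to \<open>G\<close>.\<close>
  have "z j \<otimes> x i \<in> I"
    using ann[OF blank[OF p(2)]] bilin_mat_unit[OF x z, of i j] p(2) ij by (simp add: blank_def)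
  then show False using p(1) ij G by blast
qed

end

section \<open>Average kernel sizes over finite chain rings\<close>

context cring
begin

lemma cgenideal_eq_image: "c \<in> carrier R \<Longrightarrow> PIdl c = (\<otimes>) c ` carrier R"
  unfolding cgenideal_def by (auto simp: m_comm)

lemma mem_Ker_iff:
  assumes "x \<in> vectors R d"
  shows "x \<in> Ker R d e a \<longleftrightarrow> vec_mat R d e x a = (\<lambda>j\<in>{1..e}. \<zero>)"
proof
  assume "vec_mat R d e x a = (\<lambda>j\<in>{1..e}. \<zero>)"
  from fun_cong[OF this] show "x \<in> Ker R d e a"
    using assms unfolding Ker_def vec_mat_def by (auto, metis)
qed (auto simp: Ker_def vec_mat_def intro!: restrict_ext)

text \<open>The first isomorphism theorem for a \<mapsto> x a in counting form: translation by b
  carries the kernel bijectively onto the fibre through b. The share of matrices of \<open>M\<close>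
  that kill \<open>x\<close> is thus the reciprocal of the size of x M.\<close>

lemma vec_mat_fibres:
  assumes M: "mat_submodule R d e M" "finite M" and x: "x \<in> vectors R d"
  shows "card M = card (vec_mat R d e x ` M) * card {a \<in> M. x \<in> Ker R d e a}"
proof -
  let ?f = "vec_mat R d e x" and ?K = "{a \<in> M. x \<in> Ker R d e a}"
  have Mm: "a \<in> M \<Longrightarrow> a \<in> matrices R d e" for a using M by (auto simp: mat_submodule_def)
  have fib: "card {a \<in> M. ?f a = ?f b} = card ?K" if b: "b \<in> M" for b
  proof -
    have bc: "b ij \<in> carrier R" if "ij \<in> grid d e" for ij using Mm[OF b] that by (rule matrices_entry)
    have fc: "?f a j \<in> carrier R" if "a \<in> M" "j \<in> {1..e}" for a j
      using vec_mat_closed[OF x Mm[OF that(1)]] that(2) by (rule vectors_entry)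
    \<comment> \<open>Formulated for any two scalars with sum zero, so that it covers translation by
      b and by -b in either order.\<close>
    have inv: "mat_lin R d e (mat_lin R d e a c b) c' b = a"
      if a: "a \<in> M" and c: "c \<in> carrier R" "c' \<in> carrier R" "c \<oplus> c' = \<zero>" for a c c'
    proof -
      have ent: "a ij \<oplus> c \<otimes> b ij \<oplus> c' \<otimes> b ij = a ij" if ij: "ij \<in> grid d e" for ij
      proof -
        have ac: "a ij \<in> carrier R" using Mm[OF a] ij by (rule matrices_entry)
        have "a ij \<oplus> c \<otimes> b ij \<oplus> c' \<otimes> b ij = a ij \<oplus> (c \<oplus> c') \<otimes> b ij"
          using ac bc[OF ij] c(1,2) by algebra
        then show ?thesis using c(3) ac bc[OF ij] by simp
      qed
      have "mat_lin R d e (mat_lin R d e a c b) c' b = restrict a (grid d e)"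
        unfolding mat_lin_def by (rule restrict_ext) (simp add: ent)
      also have "\<dots> = a" using Mm[OF a] unfolding matrices_def by (auto simp: PiE_iff extensional_restrict)
      finally show ?thesis .
    qed
    have fK: "a \<in> ?K \<longleftrightarrow> a \<in> M \<and> ?f a = (\<lambda>j\<in>{1..e}. \<zero>)" for a using mem_Ker_iff[OF x] by simp
    have lin: "mat_lin R d e a c b \<in> M" "?f (mat_lin R d e a c b) = (\<lambda>j\<in>{1..e}. ?f a j \<oplus> c \<otimes> ?f b j)"
      if "a \<in> M" "c \<in> carrier R" for a c
      using that b M(1) vec_mat_lin[OF x Mm[OF that(1)] Mm[OF b] that(2)] by (auto simp: mat_submodule_def)
    have fb: "?f b = (\<lambda>j\<in>{1..e}. ?f b j)" unfolding vec_mat_def by (auto simp: restrict_def)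
    have "bij_betw (\<lambda>a. mat_lin R d e a \<one> b) ?K {a \<in> M. ?f a = ?f b}"
    proof (rule bij_betw_byWitness[where f' = "\<lambda>a. mat_lin R d e a (\<ominus> \<one>) b"])
      show "\<forall>a\<in>?K. mat_lin R d e (mat_lin R d e a \<one> b) (\<ominus> \<one>) b = a"
        using inv by (simp add: r_neg)
      show "\<forall>a\<in>{a \<in> M. ?f a = ?f b}. mat_lin R d e (mat_lin R d e a (\<ominus> \<one>) b) \<one> b = a"
        using inv by (simp add: l_neg)
      show "(\<lambda>a. mat_lin R d e a \<one> b) ` ?K \<subseteq> {a \<in> M. ?f a = ?f b}"
      proof (rule image_subsetI)
        fix a assume "a \<in> ?K"
        then have a: "a \<in> M" "?f a = (\<lambda>j\<in>{1..e}. \<zero>)" using fK by blast+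
        have "?f (mat_lin R d e a \<one> b) = (\<lambda>j\<in>{1..e}. ?f a j \<oplus> \<one> \<otimes> ?f b j)" using lin(2) a(1) by blast
        also have "\<dots> = (\<lambda>j\<in>{1..e}. ?f b j)" by (rule restrict_ext) (use a fc[OF b] in simp)
        finally show "mat_lin R d e a \<one> b \<in> {a \<in> M. ?f a = ?f b}" using lin(1)[OF a(1)] fb by simp
      qed
      show "(\<lambda>a. mat_lin R d e a (\<ominus> \<one>) b) ` {a \<in> M. ?f a = ?f b} \<subseteq> ?K"
      proof (rule image_subsetI)
        fix a assume "a \<in> {a \<in> M. ?f a = ?f b}"
        then have a: "a \<in> M" "?f a = ?f b" by blast+
        have "?f (mat_lin R d e a (\<ominus> \<one>) b) = (\<lambda>j\<in>{1..e}. ?f a j \<oplus> (\<ominus> \<one>) \<otimes> ?f b j)"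
          using lin(2) a(1) by blast
        also have "\<dots> = (\<lambda>j\<in>{1..e}. \<zero>)"
          by (rule restrict_ext) (use a(2) fc[OF b] in \<open>simp add: l_minus r_neg\<close>)
        finally show "mat_lin R d e a (\<ominus> \<one>) b \<in> ?K" using lin(1)[OF a(1)] fK by simp
      qed
    qed
    then show ?thesis by (simp add: bij_betw_same_card)
  qed
  have "card M = (\<Sum>w\<in>?f ` M. card {a \<in> M. ?f a = w})"
    using sum.image_gen[OF M(2), of "\<lambda>_. 1::nat" ?f] by simp
  also have "\<dots> = (\<Sum>w\<in>?f ` M. card ?K)" by (intro sum.cong) (use fib in auto)
  finally show ?thesis by simp
qed

text \<open>Scaling commutes with the action, so the image is c times the full module, and entrywise
  this is the principal ideal of \<open>c\<close>.\<close>

lemma vec_mat_scale_image: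
  assumes M: "M \<subseteq> matrices R d e" and y: "y \<in> vectors R d" and c: "c \<in> carrier R"
    and surj: "vec_mat R d e y ` M = vectors R e"
  shows "vec_mat R d e (\<lambda>i\<in>{1..d}. c \<otimes> y i) ` M = {1..e} \<rightarrow>\<^sub>E PIdl c"
proof -
  have scale: "vec_mat R d e (\<lambda>i\<in>{1..d}. c \<otimes> y i) a = (\<lambda>j\<in>{1..e}. c \<otimes> vec_mat R d e y a j)"
    if a: "a \<in> M" for a
    unfolding vec_mat_def
  proof (rule restrict_ext)
    fix j assume j: "j \<in> {1..e}"
    have car: "y i \<in> carrier R" "a (i, j) \<in> carrier R" if "i \<in> {1..d}" for i
      using that j vectors_entry[OF y] matrices_entry[of a R d e] a M by auto
    have "(\<Oplus>i\<in>{1..d}. (\<lambda>i\<in>{1..d}. c \<otimes> y i) i \<otimes> a (i, j)) = (\<Oplus>i\<in>{1..d}. c \<otimes> (y i \<otimes> a (i, j)))"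
      using car c by (intro finsum_cong') (auto simp: m_assoc)
    also have "\<dots> = c \<otimes> (\<Oplus>i\<in>{1..d}. y i \<otimes> a (i, j))"
      using car c by (intro finsum_rdistr[symmetric]) auto
    finally show "(\<Oplus>i\<in>{1..d}. (\<lambda>i\<in>{1..d}. c \<otimes> y i) i \<otimes> a (i, j))
        = c \<otimes> (\<lambda>j\<in>{1..e}. \<Oplus>i\<in>{1..d}. y i \<otimes> a (i, j)) j" using j by simp
  qed
  have "vec_mat R d e (\<lambda>i\<in>{1..d}. c \<otimes> y i) ` M = (\<lambda>v. \<lambda>j\<in>{1..e}. c \<otimes> v j) ` vec_mat R d e y ` M"
    unfolding image_image by (rule image_cong) (use scale in auto)
  also have "\<dots> = (\<lambda>v. \<lambda>j\<in>{1..e}. c \<otimes> v j) ` vectors R e" using surj by simp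
  also have "\<dots> = {1..e} \<rightarrow>\<^sub>E PIdl c"
  proof
    show "(\<lambda>v. \<lambda>j\<in>{1..e}. c \<otimes> v j) ` vectors R e \<subseteq> {1..e} \<rightarrow>\<^sub>E PIdl c"
      using c by (auto simp: vectors_def cgenideal_eq_image PiE_iff)
    show "{1..e} \<rightarrow>\<^sub>E PIdl c \<subseteq> (\<lambda>v. \<lambda>j\<in>{1..e}. c \<otimes> v j) ` vectors R e"
    proof
      fix w assume w: "w \<in> {1..e} \<rightarrow>\<^sub>E PIdl c"
      then have "\<forall>j\<in>{1..e}. \<exists>r\<in>carrier R. w j = c \<otimes> r"
        using c by (auto simp: cgenideal_eq_image PiE_iff)
      then obtain v where "\<forall>j\<in>{1..e}. v j \<in> carrier R \<and> w j = c \<otimes> v j"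
        unfolding Bex_def bchoice_iff by blast
      then have v: "v j \<in> carrier R \<and> w j = c \<otimes> v j" if "j \<in> {1..e}" for j
        using that by blast
      have "restrict v {1..e} \<in> vectors R e" using v by (auto simp: vectors_def)
      moreover have "w = (\<lambda>j\<in>{1..e}. c \<otimes> restrict v {1..e} j)"
        using v w by (auto simp: PiE_iff extensional_def restrict_def fun_eq_iff)
      ultimately show "w \<in> (\<lambda>v. \<lambda>j\<in>{1..e}. c \<otimes> v j) ` vectors R e" by blast
    qed
  qed
  finally show ?thesis .
qed

end

section \<open>Summation over the layers of a finite chain ring\<close>

text \<open>Intended for the chain of vectors divisible by successive powers of a uniformiser: the
  summand is constant on each layer V k - V (k+1).\<close>

lemma sum_filtration:
  fixes f :: "'a \<Rightarrow> 'b :: comm_monoid_add"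
  assumes "finite (V 0)" "\<And>k. V (Suc k) \<subseteq> V k"
  shows "sum f (V 0) = sum f (V n) + (\<Sum>k<n. sum f (V k - V (Suc k)))"
proof (induction n)
  case (Suc n)
  have "finite (V n)" using assms by (induction n) (auto intro: finite_subset)
  then have "sum f (V n) = sum f (V (Suc n)) + sum f (V n - V (Suc n))"
    using assms(2)[of n] sum.subset_diff[of "V (Suc n)" "V n" f] by (simp add: add.commute)
  then show ?case using Suc by (simp add: ac_simps)
qed simp

text \<open>The intended instance is the quotient of a discrete valuation ring by the n-th power of
  its maximal ideal, with \<open>p\<close> the class of a uniformiser and \<open>q\<close> the size
  of the residue field. An infinite set has \<open>card\<close> 0, so the case k = 0 together with q
  > 0 makes the ring finite. For n = 0 it is the zero ring.\<close>

locale finite_chain_ring = cring R for R (structure) +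
  fixes p n q
  assumes p: "p \<in> carrier R" and q: "q > 0"
    and card_power: "\<And>k. k \<le> n \<Longrightarrow> card (PIdl (p [^] k)) = q ^ (n - k)"
    and unit_or: "\<And>r. r \<in> carrier R \<Longrightarrow> r \<notin> PIdl p \<Longrightarrow> r \<in> Units R"
begin

lemma PIdl_power_Suc_subset: "PIdl (p [^] Suc k) \<subseteq> PIdl (p [^] k)"
proof
  fix r assume "r \<in> PIdl (p [^] Suc k)"
  then obtain s where s: "s \<in> carrier R" "r = s \<otimes> (p [^] k \<otimes> p)" by (auto simp: cgenideal_def)
  then have "r = (s \<otimes> p) \<otimes> p [^] k" using p by (simp add: m_ac)
  then show "r \<in> PIdl (p [^] k)" using s p by (auto simp: cgenideal_def)
qed

lemma PIdl_power_0: "PIdl (p [^] (0::nat)) = carrier R"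
  by (auto simp: cgenideal_def) (metis r_one)

lemma PIdl_power_n: "PIdl (p [^] n) = {\<zero>}"
proof -
  have "\<zero> \<in> PIdl (p [^] n)" using p by (auto simp: cgenideal_def intro!: exI[of _ \<zero>])
  moreover have "card (PIdl (p [^] n)) = 1" using card_power[of n] by simp
  ultimately show ?thesis by (metis card_1_singletonE singletonD)
qed

lemma finite_carrier: "finite (carrier R)"
  using card_power[of 0] q unfolding PIdl_power_0 by (intro card_ge_0_finite) simp

text \<open>The summand 1 is the share of x = 0. The k-th summand belongs to the vectors divisible
  by p^k but not by p^(k+1): the numerator counts them, and each contributes the reciprocal of |x M|
  = q^((n-k) e).\<close>

lemma ask_eq:
  assumes M: "mat_submodule R d e M"
    and surj: "\<And>y i. y \<in> vectors R d \<Longrightarrow> i \<in> {1..d} \<Longrightarrow> y i \<notin> PIdl p \<Longrightarrow> vec_mat R d e y ` M = vectors R e"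
  shows "ask R d e M = 1 + (\<Sum>k<n. (of_nat q ^ ((n - k) * d) - of_nat q ^ ((n - Suc k) * d)) / of_nat q ^ ((n - k) * e))"
proof -
  define V where "V k = {1..d} \<rightarrow>\<^sub>E PIdl (p [^] k)" for k :: nat
  have V0: "V 0 = vectors R d" unfolding V_def vectors_def PIdl_power_0 ..
  have finV: "finite (vectors R d)" unfolding vectors_def using finite_carrier by (intro finite_PiE) auto
  have finM: "finite M"
  proof (rule finite_subset)
    show "M \<subseteq> matrices R d e" using M by (simp add: mat_submodule_def)
    show "finite (matrices R d e)" unfolding matrices_def using finite_carrier by (intro finite_PiE) auto
  qed
  have Mne: "card M > 0" using finM M by (auto simp: mat_submodule_def card_gt_0_iff)
  have VSuc: "V (Suc k) \<subseteq> V k" for k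
    unfolding V_def using PIdl_power_Suc_subset by (intro PiE_mono) auto
  have cardV: "card (V k) = q ^ ((n - k) * d)" if "k \<le> n" for k
    unfolding V_def using card_power[OF that] by (simp add: card_PiE power_mult)
  define F where "F x = card {a \<in> M. x \<in> Ker R d e a}" for x
  have Fn: "of_nat (F x) = (of_nat (card M) :: rat)" if "x \<in> V n" for x
  proof -
    have "x \<in> Ker R d e a" if a: "a \<in> M" for a
    proof -
      have xV: "x \<in> vectors R d" using \<open>x \<in> V n\<close> by (auto simp: V_def vectors_def PIdl_power_n PiE_iff)
      have am: "a (i, j) \<in> carrier R" if "i \<in> {1..d}" "j \<in> {1..e}" for i j
        using a M matrices_entry[of a R d e "(i, j)"] that by (auto simp: mat_submodule_def)
      have "(\<Oplus>i\<in>{1..d}. x i \<otimes> a (i, j)) = \<zero>" if j: "j \<in> {1..e}" for j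
      proof -
        have "(\<Oplus>i\<in>{1..d}. x i \<otimes> a (i, j)) = (\<Oplus>i\<in>{1..d}. \<zero>)"
          using \<open>x \<in> V n\<close> am j by (intro finsum_cong') (auto simp: V_def PIdl_power_n PiE_iff)
        then show ?thesis by simp
      qed
      then show ?thesis using xV unfolding Ker_def by blast
    qed
    then have "{a \<in> M. x \<in> Ker R d e a} = M" by blast
    then show ?thesis unfolding F_def by simp
  qed
  have Fk: "of_nat (F x) = (of_nat (card M) / of_nat q ^ ((n - k) * e) :: rat)"
    if k: "k < n" and x: "x \<in> V k - V (Suc k)" for k x
  proof -
    have pk: "p [^] k \<in> carrier R" using p by simp
    have "\<forall>i\<in>{1..d}. \<exists>r\<in>carrier R. x i = p [^] k \<otimes> r"
    proof
      fix i assume "i \<in> {1..d}"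
      then have "x i \<in> PIdl (p [^] k)" using x by (auto simp: V_def)
      then show "\<exists>r\<in>carrier R. x i = p [^] k \<otimes> r" using pk by (auto simp: cgenideal_eq_image)
    qed
    \<comment> \<open>Division by p^k need not be unique, but any choice of \<open>y\<close> serves:
      if all its entries were divisible by \<open>p\<close>, then \<open>x\<close> would lie in the
      next layer.\<close>
    then obtain y where "\<forall>i\<in>{1..d}. y i \<in> carrier R \<and> x i = p [^] k \<otimes> y i"
      unfolding Bex_def bchoice_iff by blast
    then have y: "y i \<in> carrier R \<and> x i = p [^] k \<otimes> y i" if "i \<in> {1..d}" for i
      using that by blast
    have xy: "x = (\<lambda>i\<in>{1..d}. p [^] k \<otimes> restrict y {1..d} i)"
      using y x by (auto simp: V_def PiE_iff extensional_def restrict_def fun_eq_iff)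
    have yv: "restrict y {1..d} \<in> vectors R d" using y by (auto simp: vectors_def)
    have "\<exists>i\<in>{1..d}. y i \<notin> PIdl p"
    proof (rule ccontr)
      assume "\<not> (\<exists>i\<in>{1..d}. y i \<notin> PIdl p)"
      then have all: "y i \<in> PIdl p" if "i \<in> {1..d}" for i using that by blast
      have "x i \<in> PIdl (p [^] Suc k)" if i: "i \<in> {1..d}" for i
      proof -
        obtain s where "s \<in> carrier R" "y i = s \<otimes> p" using all[OF i] by (auto simp: cgenideal_def)
        then have "x i = s \<otimes> p [^] Suc k" using y[OF i] p by (simp add: m_ac)
        then show ?thesis using \<open>s \<in> carrier R\<close> by (auto simp: cgenideal_def)
      qed
      then have "x \<in> V (Suc k)" using x by (auto simp: V_def PiE_iff)
      then show False using x by blast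
    qed
    then obtain i where i: "i \<in> {1..d}" "y i \<notin> PIdl p" by blast
    have "vec_mat R d e (restrict y {1..d}) ` M = vectors R e" using surj[OF yv i(1)] i by simp
    then have "vec_mat R d e x ` M = {1..e} \<rightarrow>\<^sub>E PIdl (p [^] k)"
      unfolding xy using M by (intro vec_mat_scale_image yv pk) (simp add: mat_submodule_def)
    then have "card (vec_mat R d e x ` M) = q ^ ((n - k) * e)"
      using card_power[of k] k by (simp add: card_PiE power_mult)
    moreover have "x \<in> vectors R d"
      unfolding xy vectors_def using y pk by auto
    ultimately have "card M = q ^ ((n - k) * e) * F x"
      unfolding F_def using vec_mat_fibres[OF M finM, of x] by simp
    then show ?thesis using q by simp
  qed
  have "(\<Sum>a\<in>M. of_nat (card (Ker R d e a))) = (\<Sum>a\<in>M. \<Sum>x\<in>vectors R d. if x \<in> Ker R d e a then 1 else (0::rat))"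
  proof (rule sum.cong)
    fix a
    have "Ker R d e a \<subseteq> vectors R d" by (auto simp: Ker_def)
    then have "vectors R d \<inter> {x. x \<in> Ker R d e a} = Ker R d e a" by blast
    then show "of_nat (card (Ker R d e a)) = (\<Sum>x\<in>vectors R d. if x \<in> Ker R d e a then 1 else (0::rat))"
      using finV by (simp add: sum.If_cases)
  qed simp
  also have "\<dots> = (\<Sum>x\<in>vectors R d. \<Sum>a\<in>M. if x \<in> Ker R d e a then 1 else 0)" by (rule sum.swap)
  also have "\<dots> = (\<Sum>x\<in>V 0. of_nat (F x))"
    unfolding V0 F_def using finM by (intro sum.cong) (auto simp: sum.If_cases Int_def)
  also have "\<dots> = (\<Sum>x\<in>V n. of_nat (F x)) + (\<Sum>k<n. \<Sum>x\<in>V k - V (Suc k). of_nat (F x))"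
    using finV VSuc V0 by (intro sum_filtration) auto
  also have "(\<Sum>x\<in>V n. of_nat (F x)) = (of_nat (card M) :: rat)"
    using Fn cardV[of n] by simp
  also have "(\<Sum>k<n. \<Sum>x\<in>V k - V (Suc k). of_nat (F x)) = (\<Sum>k<n. of_nat (card M) *
      ((of_nat q ^ ((n - k) * d) - of_nat q ^ ((n - Suc k) * d)) / of_nat q ^ ((n - k) * e)) :: rat)"
  proof (rule sum.cong)
    fix k assume k: "k \<in> {..<n}"
    have fink: "finite (V j)" for j
      using finV V0 VSuc by (induction j) (auto intro: finite_subset)
    have "of_nat (card (V k - V (Suc k))) = (of_nat (card (V k)) - of_nat (card (V (Suc k))) :: rat)"
      using VSuc[of k] fink by (simp add: card_Diff_subset card_mono of_nat_diff)
    then show "(\<Sum>x\<in>V k - V (Suc k). of_nat (F x)) = of_nat (card M) *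
      ((of_nat q ^ ((n - k) * d) - of_nat q ^ ((n - Suc k) * d)) / of_nat q ^ ((n - k) * e) :: rat)"
      using Fk[of k] k cardV[of k] cardV[of "Suc k"] by simp
  qed simp
  finally have "(\<Sum>a\<in>M. of_nat (card (Ker R d e a))) = of_nat (card M) * (1 + (\<Sum>k<n.
      ((of_nat q ^ ((n - k) * d) - of_nat q ^ ((n - Suc k) * d)) / of_nat q ^ ((n - k) * e) :: rat)))"
    by (simp only: sum_distrib_left distrib_left mult_1_right)
  then show ?thesis unfolding ask_def using Mne by simp
qed

end

section \<open>The generating function as a rational function\<close>

text \<open>With Q = q^(d-e) and s = q^(-e), multiplication by 1 - T passes to the differences
  Q^(n+1) - Q^n s of consecutive coefficients, and multiplication by 1 - Q T cancels all of these
  except -s in degree 1.\<close>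

lemma ask_zeta_fps:
  fixes q :: rat
  assumes q: "q \<noteq> 0"
    and c: "\<And>n. c n = 1 + (\<Sum>k<n. (q ^ ((n - k) * d) - q ^ ((n - Suc k) * d)) / q ^ ((n - k) * e))"
  shows "Abs_fps c = (1 - fps_const (q powi (- int e)) * fps_X) /
      ((1 - fps_X) * (1 - fps_const (q powi (int d - int e)) * fps_X))"
proof -
  define Q where "Q = q powi (int d - int e)"
  define s where "s = q powi (- int e)"
  have Q: "Q = q ^ d / q ^ e" and s: "s = 1 / q ^ e"
    unfolding Q_def s_def using q by (simp_all add: power_int_diff power_int_minus field_simps)
  have step: "c (Suc n) - c n = Q ^ Suc n - Q ^ n * s" for n
  proof -
    \<comment> \<open>The substitution m = n - Suc k removes n from the summand, so that passing to
      n + 1 adds exactly one term.\<close>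
    have c': "c n = 1 + (\<Sum>m<n. (q ^ (Suc m * d) - q ^ (m * d)) / q ^ (Suc m * e))" for n
    proof -
      have "(\<Sum>k<n. (q ^ ((n - k) * d) - q ^ ((n - Suc k) * d)) / q ^ ((n - k) * e))
        = (\<Sum>k<n. (q ^ (Suc (n - Suc k) * d) - q ^ ((n - Suc k) * d)) / q ^ (Suc (n - Suc k) * e))"
        by (rule sum.cong) (simp_all add: Suc_diff_Suc)
      also have "\<dots> = (\<Sum>m<n. (q ^ (Suc m * d) - q ^ (m * d)) / q ^ (Suc m * e))"
        by (rule sum.nat_diff_reindex)
      finally show ?thesis using c by simp
    qed
    have "c (Suc n) - c n = (q ^ (Suc n * d) - q ^ (n * d)) / q ^ (Suc n * e)"
      unfolding c' by simp
    also have "\<dots> = Q ^ Suc n - Q ^ n * s"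
      unfolding Q s using q by (simp add: power_add power_mult power_divide field_simps power_commutes flip: power_mult_distrib)
    finally show ?thesis .
  qed
  let ?D = "(1 - fps_X) * (1 - fps_const Q * fps_X) :: rat fps"
  have "Abs_fps c * (1 - fps_X) = Abs_fps (\<lambda>n. case n of 0 \<Rightarrow> 1 | Suc m \<Rightarrow> Q ^ Suc m - Q ^ m * s)"
  proof (rule fps_ext)
    fix n show "fps_nth (Abs_fps c * (1 - fps_X)) n =
        fps_nth (Abs_fps (\<lambda>n. case n of 0 \<Rightarrow> 1 | Suc m \<Rightarrow> Q ^ Suc m - Q ^ m * s)) n"
      using c[of 0] step by (cases n) (simp_all add: algebra_simps)
  qed
  then have "Abs_fps c * ?D = Abs_fps (\<lambda>n. case n of 0 \<Rightarrow> 1 | Suc m \<Rightarrow> Q ^ Suc m - Q ^ m * s)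
      * (1 - fps_const Q * fps_X)" by (simp only: mult.assoc[symmetric])
  also have "\<dots> = 1 - fps_const s * fps_X"
  proof (rule fps_ext)
    fix n show "fps_nth (Abs_fps (\<lambda>n. case n of 0 \<Rightarrow> 1 | Suc m \<Rightarrow> Q ^ Suc m - Q ^ m * s)
      * (1 - fps_const Q * fps_X)) n = fps_nth (1 - fps_const s * fps_X) n"
      \<comment> \<open>Degrees 0 and 1 are exceptional: they give 1 and (Q - s) - Q = -s. From
        degree 2 on the terms cancel.\<close>
      by (cases n; cases "n - 1") (simp_all add: algebra_simps)
  qed
  finally have "(1 - fps_const s * fps_X) / ?D = Abs_fps c * ?D / ?D" by simp
  also have "\<dots> = Abs_fps c"
  proof (rule nonzero_mult_div_cancel_right)
    have "fps_nth ?D 0 = 1" by simp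
    then show "?D \<noteq> 0" by (metis fps_zero_nth zero_neq_one)
  qed
  finally show ?thesis unfolding Q_def s_def by simp
qed

section \<open>Quotients of discrete valuation rings\<close>

lemma carrier_Quot: "carrier (R Quot I) = (+>\<^bsub>R\<^esub>) I ` carrier R"
  by (auto simp: FactRing_def A_RCOSETS_def' a_r_coset_def')

text \<open>Coset representatives allow quotients to be counted inside the ring itself.\<close>

lemma Quot_transversal: "\<exists>T \<subseteq> carrier R. bij_betw ((+>\<^bsub>R\<^esub>) I) T (carrier (R Quot I))"
proof -
  obtain T where "T \<subseteq> carrier R" "inj_on ((+>\<^bsub>R\<^esub>) I) T" "carrier (R Quot I) = (+>\<^bsub>R\<^esub>) I ` T"
    using subset_image_inj[THEN iffD1, OF order_refl, of "carrier R" "(+>\<^bsub>R\<^esub>) I"]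
    unfolding carrier_Quot by (elim exE conjE)
  then show ?thesis by (intro exI[of _ T] conjI bij_betw_imageI) simp_all
qed

lemma (in cring) PIdl_coset_eq_iff:
  assumes "c \<in> carrier R" "x \<in> carrier R" "y \<in> carrier R"
  shows "PIdl c +> x = PIdl c +> y \<longleftrightarrow> (\<exists>r\<in>carrier R. x \<ominus> y = c \<otimes> r)"
  using quotient_eq_iff_same_a_r_cos[OF cgenideal_ideal[OF assms(1)] assms(2,3)] assms(1)
  by (auto simp: cgenideal_eq_image)

text \<open>A two-digit expansion: each class modulo a b contains t + a u for exactly one
  representative t modulo a and one representative u modulo b. The first digit is determined modulo
  a, the second after cancelling a.\<close>

lemma (in domain) card_Quot_mult:
  assumes a: "a \<in> carrier R" "a \<noteq> \<zero>" and b: "b \<in> carrier R"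
  shows "card (carrier (R Quot PIdl (a \<otimes> b))) = card (carrier (R Quot PIdl a)) * card (carrier (R Quot PIdl b))"
proof -
  obtain T where T: "T \<subseteq> carrier R" "bij_betw ((+>) (PIdl a)) T (carrier (R Quot PIdl a))"
    using Quot_transversal[of R "PIdl a"] by (elim exE conjE)
  obtain U where U: "U \<subseteq> carrier R" "bij_betw ((+>) (PIdl b)) U (carrier (R Quot PIdl b))"
    using Quot_transversal[of R "PIdl b"] by (elim exE conjE)
  have ab: "a \<otimes> b \<in> carrier R" using a b by simp
  let ?f = "\<lambda>(t, u). PIdl (a \<otimes> b) +> (t \<oplus> a \<otimes> u)"
  have "inj_on ?f (T \<times> U)"
  proof (rule inj_onI, clarify)
    fix t u t' u' assume tu: "t \<in> T" "u \<in> U" "t' \<in> T" "u' \<in> U"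
      and eq: "PIdl (a \<otimes> b) +> (t \<oplus> a \<otimes> u) = PIdl (a \<otimes> b) +> (t' \<oplus> a \<otimes> u')"
    have c: "t \<in> carrier R" "u \<in> carrier R" "t' \<in> carrier R" "u' \<in> carrier R" using tu T(1) U(1) by auto
    then obtain r where r: "r \<in> carrier R" "(t \<oplus> a \<otimes> u) \<ominus> (t' \<oplus> a \<otimes> u') = a \<otimes> b \<otimes> r"
      using eq PIdl_coset_eq_iff[OF ab, of "t \<oplus> a \<otimes> u" "t' \<oplus> a \<otimes> u'"] a b by auto
    have "t \<ominus> t' = ((t \<oplus> a \<otimes> u) \<ominus> (t' \<oplus> a \<otimes> u')) \<oplus> a \<otimes> (u' \<ominus> u)" using a c by algebra
    also have "\<dots> = a \<otimes> (b \<otimes> r \<oplus> u' \<ominus> u)" unfolding r(2) using a b c r(1) by algebra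
    finally have "PIdl a +> t = PIdl a +> t'" using PIdl_coset_eq_iff[of a t t'] a b c r(1) by auto
    then have tt: "t = t'" using T(2) tu by (auto simp: bij_betw_def inj_on_def)
    have "a \<otimes> (u \<ominus> u') = (t \<oplus> a \<otimes> u) \<ominus> (t \<oplus> a \<otimes> u')" using a c by algebra
    also have "\<dots> = a \<otimes> (b \<otimes> r)" using r tt a b by (simp add: m_assoc)
    finally have "u \<ominus> u' = b \<otimes> r" using a b c r(1) by (subst (asm) m_lcancel) auto
    then have "PIdl b +> u = PIdl b +> u'" using PIdl_coset_eq_iff[of b u u'] b c r(1) by auto
    then show "t = t' \<and> u = u'" using U(2) tu tt by (auto simp: bij_betw_def inj_on_def)
  qed
  moreover have "?f ` (T \<times> U) = carrier (R Quot PIdl (a \<otimes> b))"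
  proof
    show "?f ` (T \<times> U) \<subseteq> carrier (R Quot PIdl (a \<otimes> b))"
      using T(1) U(1) a unfolding carrier_Quot by (auto simp: subset_iff)
    show "carrier (R Quot PIdl (a \<otimes> b)) \<subseteq> ?f ` (T \<times> U)"
    proof
      fix X assume "X \<in> carrier (R Quot PIdl (a \<otimes> b))"
      then obtain x where x: "x \<in> carrier R" "X = PIdl (a \<otimes> b) +> x" unfolding carrier_Quot by blast
      obtain t where t: "t \<in> T" "PIdl a +> x = PIdl a +> t"
        using T(2) x(1) unfolding bij_betw_def carrier_Quot by (metis imageE imageI)
      then have tc: "t \<in> carrier R" using T(1) by blast
      obtain s where s: "s \<in> carrier R" "x \<ominus> t = a \<otimes> s"
        using t PIdl_coset_eq_iff[of a x t] a x(1) tc by auto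
      obtain u where u: "u \<in> U" "PIdl b +> s = PIdl b +> u"
        using U(2) s(1) unfolding bij_betw_def carrier_Quot by (metis imageE imageI)
      then have uc: "u \<in> carrier R" using U(1) by blast
      obtain r where r: "r \<in> carrier R" "s \<ominus> u = b \<otimes> r"
        using u PIdl_coset_eq_iff[of b s u] b s(1) uc by auto
      have "x \<ominus> (t \<oplus> a \<otimes> u) = (x \<ominus> t) \<ominus> a \<otimes> u" using a x(1) tc uc by algebra
      also have "\<dots> = a \<otimes> (s \<ominus> u)" unfolding s(2) using a s(1) uc by algebra
      also have "\<dots> = a \<otimes> b \<otimes> r" unfolding r(2) using a b r(1) by (simp add: m_assoc)
      finally have "X = PIdl (a \<otimes> b) +> (t \<oplus> a \<otimes> u)"
        using PIdl_coset_eq_iff[OF ab, of x "t \<oplus> a \<otimes> u"] x a tc uc r(1) by auto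
      then show "X \<in> ?f ` (T \<times> U)" using t(1) u(1) by auto
    qed
  qed
  ultimately have "card (carrier (R Quot PIdl (a \<otimes> b))) = card (T \<times> U)"
    by (metis card_image)
  also have "\<dots> = card (carrier (R Quot PIdl a)) * card (carrier (R Quot PIdl b))"
    using bij_betw_same_card[OF T(2)] bij_betw_same_card[OF U(2)] by (simp add: card_cartesian_product)
  finally show ?thesis .
qed

text \<open>Multiplication by a identifies the quotient by b with the ideal of a modulo a b: by
  cancellation, a s and a s' agree modulo a b exactly when s and s' agree modulo b.\<close>

lemma (in domain) card_PIdl_Quot:
  assumes a: "a \<in> carrier R" "a \<noteq> \<zero>" and b: "b \<in> carrier R"
  shows "card (PIdl\<^bsub>R Quot PIdl (a \<otimes> b)\<^esub> (PIdl (a \<otimes> b) +> a)) = card (carrier (R Quot PIdl b))"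
proof -
  let ?I = "PIdl (a \<otimes> b)"
  have ab: "a \<otimes> b \<in> carrier R" using a b by simp
  interpret I: ideal ?I R using ab by (rule cgenideal_ideal)
  interpret h: ring_hom_cring R "R Quot ?I" "(+>) ?I"
    using I.rcos_ring_hom_cring is_cring by blast
  obtain U where U: "U \<subseteq> carrier R" "bij_betw ((+>) (PIdl b)) U (carrier (R Quot PIdl b))"
    using Quot_transversal[of R "PIdl b"] by (elim exE conjE)
  have gen: "PIdl\<^bsub>R Quot ?I\<^esub> (?I +> a) = (\<lambda>s. ?I +> (a \<otimes> s)) ` carrier R"
    using a by (auto simp: h.S.cgenideal_eq_image carrier_Quot)
  have "inj_on (\<lambda>s. ?I +> (a \<otimes> s)) U"
  proof (rule inj_onI)
    fix u v assume uv: "u \<in> U" "v \<in> U" and eq: "?I +> (a \<otimes> u) = ?I +> (a \<otimes> v)"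
    have c: "u \<in> carrier R" "v \<in> carrier R" using uv U(1) by auto
    then obtain r where r: "r \<in> carrier R" "a \<otimes> u \<ominus> a \<otimes> v = a \<otimes> b \<otimes> r"
      using eq PIdl_coset_eq_iff[OF ab, of "a \<otimes> u" "a \<otimes> v"] a by auto
    have "a \<otimes> (u \<ominus> v) = a \<otimes> u \<ominus> a \<otimes> v" using a c by algebra
    also have "\<dots> = a \<otimes> (b \<otimes> r)" using r a b by (simp add: m_assoc)
    finally have "u \<ominus> v = b \<otimes> r" using a b c r(1) by (subst (asm) m_lcancel) auto
    then have "PIdl b +> u = PIdl b +> v" using PIdl_coset_eq_iff[of b u v] b c r(1) by auto
    then show "u = v" using U(2) uv by (auto simp: bij_betw_def inj_on_def)
  qed
  moreover have "(\<lambda>s. ?I +> (a \<otimes> s)) ` U = (\<lambda>s. ?I +> (a \<otimes> s)) ` carrier R"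
  proof
    show "(\<lambda>s. ?I +> (a \<otimes> s)) ` carrier R \<subseteq> (\<lambda>s. ?I +> (a \<otimes> s)) ` U"
    proof (rule image_subsetI)
      fix s assume s: "s \<in> carrier R"
      obtain u where u: "u \<in> U" "PIdl b +> s = PIdl b +> u"
        using U(2) s unfolding bij_betw_def carrier_Quot by (metis imageE imageI)
      then have uc: "u \<in> carrier R" using U(1) by blast
      obtain r where r: "r \<in> carrier R" "s \<ominus> u = b \<otimes> r"
        using u PIdl_coset_eq_iff[of b s u] b s uc by auto
      have "a \<otimes> s \<ominus> a \<otimes> u = a \<otimes> (s \<ominus> u)" using a s uc by algebra
      also have "\<dots> = a \<otimes> b \<otimes> r" unfolding r(2) using a b r(1) by (simp add: m_assoc)
      finally have "?I +> (a \<otimes> s) = ?I +> (a \<otimes> u)"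
        using PIdl_coset_eq_iff[OF ab, of "a \<otimes> s" "a \<otimes> u"] s a uc r(1) by auto
      then show "?I +> (a \<otimes> s) \<in> (\<lambda>s. ?I +> (a \<otimes> s)) ` U" using u(1) by blast
    qed
  qed (use U(1) in blast)
  ultimately show ?thesis
    unfolding gen using bij_betw_same_card[OF U(2)] by (metis card_image)
qed

lemma (in domain) card_Quot_power:
  assumes "a \<in> carrier R" "a \<noteq> \<zero>"
  shows "card (carrier (R Quot PIdl (a [^] (n::nat)))) = card (carrier (R Quot PIdl a)) ^ n"
proof (induction n)
  case 0
  have "PIdl \<one> = carrier R" by (auto simp: cgenideal_def) (metis r_one)
  moreover have "carrier (R Quot carrier R) = {carrier R}"
    unfolding carrier_Quot using a_coset_join2[of _ "carrier R"] add.subgroup_self by auto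
  ultimately show ?case by simp
next
  case (Suc n)
  have "a [^] n \<noteq> \<zero>" using assms by (induction n) (auto simp: integral_iff)
  then show ?case using Suc card_Quot_mult[of "a [^] n" a] assms by simp
qed

text \<open>Replaces powers in the monoid of ideals by powers of a generator, so that the counting
  of principal quotients applies.\<close>

lemma (in cring) ideal_pow_PIdl:
  assumes "a \<in> carrier R"
  shows "ideal_pow R (PIdl a) n = PIdl (a [^] n)"
proof (induction n)
  case 0
  have "PIdl \<one> = carrier R" by (auto simp: cgenideal_def) (metis r_one)
  then show ?case by (simp add: ideal_pow_def ideals_set_def)
next
  case (Suc n)
  have an: "a [^] n \<in> carrier R" using assms by simp
  have "ideal_pow R (PIdl a) (Suc n) = ideal_prod R (PIdl (a [^] n)) (PIdl a)"
    using Suc by (simp add: ideal_pow_def ideals_set_def)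
  also have "\<dots> = Idl (PIdl (a [^] n \<otimes> a))"
    using ideal_prod_eq_genideal[OF cgenideal_ideal[OF an] cgenideal_ideal[OF assms]]
      cgenideal_prod[OF an assms] by simp
  also have "\<dots> = PIdl (a [^] Suc n)"
    using cgenideal_ideal[of "a [^] n \<otimes> a"] an assms genideal_self[of "PIdl (a [^] n \<otimes> a)"]
      genideal_minimal[of "PIdl (a [^] n \<otimes> a)" "PIdl (a [^] n \<otimes> a)"]
    by (auto dest: ideal.Icarr)
  finally show ?case .
qed

text \<open>A non-zero non-unit has an irreducible divisor, which generates a maximal ideal in a
  principal ideal domain; by locality this ideal is \<open>P\<close>.\<close>

lemma (in discrete_valuation_ring) not_in_P_Units:
  assumes r: "r \<in> carrier R" "r \<notin> P"
  shows "r \<in> Units R"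
proof (rule ccontr)
  assume n: "r \<notin> Units R"
  interpret P: maximalideal P R by (rule maximal)
  have "r \<noteq> \<zero>" using r(2) P.zero_closed by blast
  then obtain b where b: "b \<in> carrier R" "ring_irreducible b" "b divides r"
    using exists_irreducible_divisor[of r] r n by blast
  have "PIdl b = P" using local irreducible_imp_maximalideal b by blast
  moreover have "PIdl r \<subseteq> PIdl b" using to_contain_is_to_divide b r by blast
  ultimately show False using r cgenideal_self by blast
qed

text \<open>The cosets of \<open>P\<close> are basic open sets, namely those with exponent 1. They
  cover the ring and are pairwise disjoint, so a finite subcover has to contain all of them.\<close>

lemma (in compact_dvr) finite_residue_field: "finite (carrier (R Quot P))"
proof -
  interpret P: maximalideal P R by (rule maximal)
  let ?B = "{ideal_pow R P n +> a |n a. a \<in> carrier R}"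
  obtain a where a: "a \<in> carrier R" "P = PIdl a" using exists_gen[OF P.is_ideal] by blast
  have P1: "ideal_pow R P 1 = P" using ideal_pow_PIdl[OF a(1), of 1] a by simp
  have sub: "X \<subseteq> carrier R" if X: "X \<in> ?B" for X
  proof -
    obtain n b where nb: "X = ideal_pow R P n +> b" "b \<in> carrier R"
      using X by blast
    interpret I: ideal "PIdl (a [^] n)" R using a(1) by (intro cgenideal_ideal) simp
    show ?thesis
      unfolding nb(1) a(2) ideal_pow_PIdl[OF a(1)] by (rule a_r_coset_subset_G[OF I.a_subset nb(2)])
  qed
  have cov: "\<Union>(carrier (R Quot P)) = carrier R"
    unfolding FactRing_def using P.a_rcosets_part_G by simp
  have QB: "carrier (R Quot P) \<subseteq> ?B"
    unfolding carrier_Quot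
  proof (rule image_subsetI)
    fix a assume "a \<in> carrier R"
    moreover have "P +> a = ideal_pow R P 1 +> a" using P1 by simp
    ultimately show "P +> a \<in> ?B" by blast
  qed
  have top: "topspace (adic_topology R P) = carrier R"
    unfolding adic_topology_def topology_generated_by_topspace
  proof
    show "\<Union>?B \<subseteq> carrier R" using sub by (rule Union_least)
    show "carrier R \<subseteq> \<Union>?B" using Union_mono[OF QB] unfolding cov .
  qed
  have "openin (adic_topology R P) X" if "X \<in> carrier (R Quot P)" for X
    unfolding adic_topology_def using that QB by (intro topology_generated_by_Basis) (rule subsetD)
  then obtain F where F: "finite F" "F \<subseteq> carrier (R Quot P)" "carrier R \<subseteq> \<Union>F"
    using compact[unfolded compact_space_alt top, rule_format, of "carrier (R Quot P)"] cov by auto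
  have "carrier (R Quot P) \<subseteq> F"
  proof
    fix X assume X: "X \<in> carrier (R Quot P)"
    then obtain x where x: "x \<in> carrier R" "X = P +> x" unfolding carrier_Quot by blast
    obtain Y where Y: "Y \<in> F" "x \<in> Y" using F x by blast
    then obtain y where y: "y \<in> carrier R" "Y = P +> y" using F(2) unfolding carrier_Quot by blast
    have "X = Y" using P.a_repr_independence'[of x y] x y Y by simp
    then show "X \<in> F" using Y by simp
  qed
  then show ?thesis using F(1) finite_subset by blast
qed

section \<open>Relation modules\<close>

definition map_mat :: "nat \<Rightarrow> nat \<Rightarrow> ('a \<Rightarrow> 'b) \<Rightarrow> (nat \<times> nat \<Rightarrow> 'a) \<Rightarrow> nat \<times> nat \<Rightarrow> 'b" where
  "map_mat d e h a = (\<lambda>ij\<in>grid d e. h (a ij))"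

lemma matrices_mod_eq: "matrices_mod R I d e M = map_mat d e ((+>\<^bsub>R\<^esub>) I) ` M"
  by (simp add: matrices_mod_def map_mat_def)

context ring_hom_cring
begin

lemma map_mat_lin:
  assumes "a \<in> matrices R d e" "b \<in> matrices R d e" "c \<in> carrier R"
  shows "map_mat d e h (mat_lin R d e a c b) = mat_lin S d e (map_mat d e h a) (h c) (map_mat d e h b)"
  unfolding map_mat_def mat_lin_def using assms by (intro restrict_ext) (simp add: matrices_entry)

lemma map_mat_scale:
  assumes "a \<in> matrices R d e" "c \<in> carrier R"
  shows "map_mat d e h (mat_scale R d e c a) = mat_scale S d e (h c) (map_mat d e h a)"
  unfolding map_mat_def mat_scale_def using assms by (intro restrict_ext) (simp add: matrices_entry)

lemma map_mat_unit: "map_mat d e h (mat_unit R d e p) = mat_unit S d e p"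
  unfolding map_mat_def mat_unit_def by (intro restrict_ext) simp

lemma hom_Units: "r \<in> Units R \<Longrightarrow> h r \<in> Units S"
  using hom_mult[of r "inv r"] hom_mult[of "inv r" r] unfolding Units_def[of S]
  by (auto simp: R.Units_closed intro!: bexI[of _ "h (inv r)"])

text \<open>Matrices of the image lift by construction; surjectivity of \<open>h\<close> lifts the
  scalar.\<close>

lemma mat_submodule_image:
  assumes M: "mat_submodule R d e M" and surj: "h ` carrier R = carrier S"
  shows "mat_submodule S d e (map_mat d e h ` M)"
  unfolding mat_submodule_def
proof (intro conjI ballI)
  have Mm: "a \<in> M \<Longrightarrow> a \<in> matrices R d e" for a using M by (auto simp: mat_submodule_def)
  show "map_mat d e h ` M \<subseteq> matrices S d e"
  proof (rule image_subsetI)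
    fix a assume "a \<in> M"
    then show "map_mat d e h a \<in> matrices S d e"
      using matrices_entry[OF Mm] unfolding map_mat_def matrices_def[of S] by (intro restrict_PiE[THEN iffD2]) auto
  qed
  show "map_mat d e h ` M \<noteq> {}" using M by (simp add: mat_submodule_def)
  fix a b c assume "a \<in> map_mat d e h ` M" "b \<in> map_mat d e h ` M" "c \<in> carrier S"
  then obtain a' b' c' where ab: "a' \<in> M" "b' \<in> M" "c' \<in> carrier R"
    "a = map_mat d e h a'" "b = map_mat d e h b'" "c = h c'" using surj by blast
  have "mat_lin R d e a' c' b' \<in> M" using ab M by (auto simp: mat_submodule_def)
  then show "mat_lin S d e a c b \<in> map_mat d e h ` M"
    using ab map_mat_lin[OF Mm Mm, of a' b' c'] by (metis imageI)
qed

end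

context cring
begin

lemma mat_submodule_Rel:
  assumes A: "\<And>c. c \<in> C \<Longrightarrow> A c \<subseteq> grid d e" and u: "u \<in> matrices R d e"
  shows "mat_submodule R d e (Rel R d e C A u)"
proof -
  have uc: "u ij \<in> carrier R" if "ij \<in> grid d e" for ij using u that by (rule matrices_entry)
  have fin: "finite (A c)" if "c \<in> C" for c using A[OF that] finite_grid by (rule finite_subset)
  let ?z = "\<lambda>ij\<in>grid d e. \<zero>"
  have "(\<Oplus>ij\<in>A c. u ij \<otimes> ?z ij) = \<zero>" if c: "c \<in> C" for c
  proof -
    have "(\<Oplus>ij\<in>A c. u ij \<otimes> ?z ij) = (\<Oplus>ij\<in>A c. \<zero>)"
      using A[OF c] uc by (intro finsum_cong') (auto simp: subset_iff)
    then show ?thesis by simp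
  qed
  then have "?z \<in> Rel R d e C A u" by (auto simp: Rel_def matrices_def)
  moreover have "mat_lin R d e a r b \<in> Rel R d e C A u"
    if a: "a \<in> Rel R d e C A u" and b: "b \<in> Rel R d e C A u" and r: "r \<in> carrier R" for a b r
  proof -
    have ab: "a \<in> matrices R d e" "b \<in> matrices R d e" using a b by (auto simp: Rel_def)
    have "(\<Oplus>ij\<in>A c. u ij \<otimes> mat_lin R d e a r b ij) = \<zero>" if c: "c \<in> C" for c
    proof -
      have car: "u ij \<in> carrier R" "a ij \<in> carrier R" "b ij \<in> carrier R" if "ij \<in> A c" for ij
        using A[OF c] that uc matrices_entry[OF ab(1)] matrices_entry[OF ab(2)] by blast+
      have "(\<Oplus>ij\<in>A c. u ij \<otimes> mat_lin R d e a r b ij) = (\<Oplus>ij\<in>A c. u ij \<otimes> a ij \<oplus> r \<otimes> (u ij \<otimes> b ij))"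
      proof (rule finsum_cong')
        fix ij assume ij: "ij \<in> A c"
        then have "mat_lin R d e a r b ij = a ij \<oplus> r \<otimes> b ij" using A[OF c] by (auto simp: mat_lin_def)
        moreover have "u ij \<otimes> (a ij \<oplus> r \<otimes> b ij) = u ij \<otimes> a ij \<oplus> r \<otimes> (u ij \<otimes> b ij)"
          using car[OF ij] r by algebra
        ultimately show "u ij \<otimes> mat_lin R d e a r b ij = u ij \<otimes> a ij \<oplus> r \<otimes> (u ij \<otimes> b ij)" by simp
      qed (use car r in auto)
      also have "\<dots> = (\<Oplus>ij\<in>A c. u ij \<otimes> a ij) \<oplus> (\<Oplus>ij\<in>A c. r \<otimes> (u ij \<otimes> b ij))"
        using car r by (intro finsum_addf) auto
      also have "(\<Oplus>ij\<in>A c. r \<otimes> (u ij \<otimes> b ij)) = r \<otimes> (\<Oplus>ij\<in>A c. u ij \<otimes> b ij)"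
        using car r fin[OF c] by (intro finsum_rdistr[symmetric]) auto
      finally show ?thesis using a b c r by (simp add: Rel_def)
    qed
    then show ?thesis using mat_lin_closed[OF ab r] by (simp add: Rel_def)
  qed
  ultimately show ?thesis unfolding mat_submodule_def by (auto simp: Rel_def)
qed

text \<open>A blank cell occurs in none of the equations, so each of them reduces to a sum of
  zeros.\<close>

lemma mat_unit_in_Rel:
  assumes A: "\<And>c. c \<in> C \<Longrightarrow> A c \<subseteq> grid d e" and u: "u \<in> matrices R d e" and p: "blank d e C A p"
  shows "mat_unit R d e p \<in> Rel R d e C A u"
proof -
  have "(\<Oplus>ij\<in>A c. u ij \<otimes> mat_unit R d e p ij) = \<zero>" if c: "c \<in> C" for c
  proof -
    have "(\<Oplus>ij\<in>A c. u ij \<otimes> mat_unit R d e p ij) = (\<Oplus>ij\<in>A c. \<zero>)"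
    proof (rule finsum_cong')
      fix ij assume ij: "ij \<in> A c"
      then have "ij \<in> grid d e" "ij \<noteq> p" using A[OF c] p c by (auto simp: blank_def)
      then show "u ij \<otimes> mat_unit R d e p ij = \<zero>" using matrices_entry[OF u, of ij] by (simp add: mat_unit_def)
    qed auto
    then show ?thesis by simp
  qed
  then show ?thesis using mat_unit_closed by (simp add: Rel_def)
qed

text \<open>The two coefficients are swapped so that the equation of colour \<open>c\<close> reads
  u_p u_p' - u_p' u_p = 0. By disjointness no other colour contains \<open>p\<close> or
  \<open>p'\<close>.\<close>

lemma mat_unit_pair_in_Rel:
  assumes A: "partial_colouring d e C A" and u: "u \<in> matrices R d e"
    and c: "c \<in> C" and p: "p \<in> A c" "p' \<in> A c" "p \<noteq> p'"
  shows "mat_lin R d e (mat_scale R d e (u p') (mat_unit R d e p)) (\<ominus> u p) (mat_unit R d e p') \<in> Rel R d e C A u"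
    (is "?a \<in> _")
proof -
  have Ag: "A b \<subseteq> grid d e" if "b \<in> C" for b using A that by (simp add: partial_colouring_def)
  have uc: "u ij \<in> carrier R" if "ij \<in> grid d e" for ij using u that by (rule matrices_entry)
  have pg: "p \<in> grid d e" "p' \<in> grid d e" using p Ag[OF c] by auto
  have ent: "?a ij = (if ij = p then u p' else if ij = p' then \<ominus> u p else \<zero>)" if "ij \<in> grid d e" for ij
    using that uc pg p(3) by (simp add: mat_lin_def mat_scale_def mat_unit_def)
  have "(\<Oplus>ij\<in>A b. u ij \<otimes> ?a ij) = \<zero>" if b: "b \<in> C" for b
  proof (cases "b = c")
    case True
    have fin: "finite (A c)" using Ag[OF c] finite_grid by (rule finite_subset)
    let ?f = "\<lambda>ij. u ij \<otimes> ?a ij"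
    have ac: "?f ij \<in> carrier R" if "ij \<in> grid d e" for ij using ent[OF that] uc[OF that] uc pg by simp
    have Ac: "A c = insert p (insert p' (A c - {p, p'}))" using p by blast
    have "(\<Oplus>ij\<in>A c - {p, p'}. ?f ij) = (\<Oplus>ij\<in>A c - {p, p'}. \<zero>)"
    proof (rule finsum_cong')
      fix ij assume ij: "ij \<in> A c - {p, p'}"
      then have "ij \<in> grid d e" using Ag[OF c] by blast
      then show "?f ij = \<zero>" using ent[of ij] uc[of ij] ij by simp
    qed auto
    then have z: "(\<Oplus>ij\<in>A c - {p, p'}. ?f ij) = \<zero>" by simp
    have g: "ij \<in> grid d e" if "ij \<in> A c" for ij using Ag[OF c] that by blast
    have "(\<Oplus>ij\<in>A c. ?f ij) = (\<Oplus>ij\<in>insert p (insert p' (A c - {p, p'})). ?f ij)" using Ac by simp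
    also have "\<dots> = ?f p \<oplus> (\<Oplus>ij\<in>insert p' (A c - {p, p'}). ?f ij)"
      using fin p by (intro finsum_insert) (use ac g in auto)
    also have "(\<Oplus>ij\<in>insert p' (A c - {p, p'}). ?f ij) = ?f p' \<oplus> (\<Oplus>ij\<in>A c - {p, p'}. ?f ij)"
      using fin p by (intro finsum_insert) (use ac g in auto)
    also have "?f p \<oplus> (?f p' \<oplus> (\<Oplus>ij\<in>A c - {p, p'}. ?f ij)) = u p \<otimes> u p' \<oplus> u p' \<otimes> (\<ominus> u p)"
      unfolding z using ent[OF pg(1)] ent[OF pg(2)] p(3) uc[OF pg(1)] uc[OF pg(2)] by simp
    also have "\<dots> = \<zero>" using uc[OF pg(1)] uc[OF pg(2)] by algebra
    finally show ?thesis using True by simp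
  next
    case False
    then have "A b \<inter> A c = {}" using A b c by (auto simp: partial_colouring_def disjoint_family_on_def)
    then have ne: "ij \<noteq> p" "ij \<noteq> p'" if "ij \<in> A b" for ij using that p by auto
    have "(\<Oplus>ij\<in>A b. u ij \<otimes> ?a ij) = (\<Oplus>ij\<in>A b. \<zero>)"
    proof (rule finsum_cong')
      fix ij assume ij: "ij \<in> A b"
      then have "ij \<in> grid d e" using Ag[OF b] by blast
      then show "u ij \<otimes> ?a ij = \<zero>" using ent[of ij] uc[of ij] ne[OF ij] by simp
    qed auto
    then show ?thesis by simp
  qed
  moreover have "?a \<in> matrices R d e"
    using mat_unit_closed uc pg by (intro mat_lin_closed mat_scale_closed) auto
  ultimately show ?thesis by (simp add: Rel_def)
qed

end

section \<open>Reduction modulo powers of the maximal ideal\<close>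

theorem corollaryB:
  fixes R :: "('a, 'm) ring_scheme" and P :: "'a set" and q d e :: nat
    and C :: "'c set" and A :: "'c \<Rightarrow> (nat \<times> nat) set" and u :: "nat \<times> nat \<Rightarrow> 'a"
  assumes "compact_dvr R P"
    and "q = card (carrier (R Quot P))"
    and "d \<ge> 1" and "e \<ge> 1"
    and "partial_colouring d e C A"
    and "u \<in> matrices R d e" and "\<forall>ij\<in>grid d e. u ij \<in> Units R"
    and "admissible d e C A"
  shows "ask_zeta R P d e (Rel R d e C A u) =
    (1 - fps_const (of_nat q powi (- int e)) * fps_X) /
      ((1 - fps_X) * (1 - fps_const (of_nat q powi (int d - int e)) * fps_X))"
proof -
  interpret compact_dvr R P by fact
  interpret P: maximalideal P R by (rule maximal)
  obtain \<pi> where \<pi>: "\<pi> \<in> carrier R" "P = PIdl\<^bsub>R\<^esub> \<pi>" using exists_gen[OF P.is_ideal] by blast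
  have \<pi>0: "\<pi> \<noteq> \<zero>\<^bsub>R\<^esub>" using not_field \<pi> cgenideal_eq_genideal genideal_zero by auto
  have pow: "\<pi> [^]\<^bsub>R\<^esub> (k::nat) \<in> carrier R" "\<pi> [^]\<^bsub>R\<^esub> k \<noteq> \<zero>\<^bsub>R\<^esub>" for k
    using \<pi>(1) \<pi>0 by (induction k) (auto simp: integral_iff)
  \<comment> \<open>Compactness enters here: an infinite residue field would have
    \<open>card\<close> 0.\<close>
  have q: "q > 0"
    using finite_residue_field assms(2) unfolding carrier_Quot by (auto simp: card_gt_0_iff)
  have Ag: "A c \<subseteq> grid d e" if "c \<in> C" for c using assms(5) that by (simp add: partial_colouring_def)
  let ?M = "Rel R d e C A u"
  have "ask (R Quot ideal_pow R P n) d e (matrices_mod R (ideal_pow R P n) d e ?M)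
      = 1 + (\<Sum>k<n. (of_nat q ^ ((n - k) * d) - of_nat q ^ ((n - Suc k) * d)) / of_nat q ^ ((n - k) * e))" for n
  proof -
    define I where "I = ideal_pow R P n"
    define S where "S = R Quot I"
    define h where "h = (+>\<^bsub>R\<^esub>) I"
    have I: "I = PIdl\<^bsub>R\<^esub> (\<pi> [^]\<^bsub>R\<^esub> n)" unfolding I_def \<pi>(2) using \<pi>(1) by (rule ideal_pow_PIdl)
    interpret I: ideal I R unfolding I by (intro cgenideal_ideal pow)
    interpret h: ring_hom_cring R S h
      unfolding S_def h_def using is_cring by (rule I.rcos_ring_hom_cring)
    have surj: "h ` carrier R = carrier S" unfolding S_def h_def carrier_Quot ..
    have unit: "s \<in> Units S" if s: "s \<in> carrier S" "s \<notin> PIdl\<^bsub>S\<^esub> (h \<pi>)" for s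
    proof -
      obtain r where r: "r \<in> carrier R" "s = h r" using s surj by blast
      have "r \<notin> P"
      proof
        assume "r \<in> P"
        then obtain t where "t \<in> carrier R" "r = \<pi> \<otimes>\<^bsub>R\<^esub> t" using \<pi> by (auto simp: cgenideal_eq_image)
        then have "s \<in> PIdl\<^bsub>S\<^esub> (h \<pi>)" using r \<pi>(1) by (auto simp: h.S.cgenideal_eq_image)
        then show False using s by blast
      qed
      then show ?thesis using h.hom_Units not_in_P_Units r by blast
    qed
    \<comment> \<open>Splitting \<pi>^n as \<pi>^k \<pi>^(n-k) shows that the ideal of \<pi>^k in
      \<open>S\<close> is as large as the quotient of \<open>R\<close> by \<pi>^(n-k), which has
      q^(n-k) elements.\<close>
    interpret chain: finite_chain_ring S "h \<pi>" n q
    proof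
      fix k assume k: "k \<le> n"
      have "h \<pi> [^]\<^bsub>S\<^esub> k = h (\<pi> [^]\<^bsub>R\<^esub> k)" using \<pi>(1) by (induction k) auto
      moreover have "I = PIdl\<^bsub>R\<^esub> (\<pi> [^]\<^bsub>R\<^esub> k \<otimes>\<^bsub>R\<^esub> \<pi> [^]\<^bsub>R\<^esub> (n - k))"
        unfolding I using k \<pi>(1) by (simp add: nat_pow_mult)
      ultimately have "card (PIdl\<^bsub>S\<^esub> (h \<pi> [^]\<^bsub>S\<^esub> k)) = card (carrier (R Quot PIdl\<^bsub>R\<^esub> (\<pi> [^]\<^bsub>R\<^esub> (n - k))))"
        unfolding S_def h_def using card_PIdl_Quot[OF pow pow(1), of k "n - k"] by simp
      then show "card (PIdl\<^bsub>S\<^esub> (h \<pi> [^]\<^bsub>S\<^esub> k)) = q ^ (n - k)"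
        using card_Quot_power[OF \<pi>(1) \<pi>0] assms(2) \<pi>(2) by simp
    qed (use \<pi>(1) q unit in auto)
    let ?N = "map_mat d e h ` ?M"
    have N: "mat_submodule S d e ?N"
      using mat_submodule_Rel[OF Ag assms(6)] surj by (intro h.mat_submodule_image)
    have "ask S d e ?N = 1 + (\<Sum>k<n. (of_nat q ^ ((n - k) * d) - of_nat q ^ ((n - Suc k) * d)) / of_nat q ^ ((n - k) * e))"
    proof (rule chain.ask_eq[OF N])
      fix y i assume y: "y \<in> vectors S d" "i \<in> {1..d}" "y i \<notin> PIdl\<^bsub>S\<^esub> (h \<pi>)"
      show "vec_mat S d e y ` ?N = vectors S e"
      proof (rule h.S.vec_mat_surj[OF _ unit N assms(8) Ag _ _ y])
        show "ideal (PIdl\<^bsub>S\<^esub> (h \<pi>)) S" using \<pi>(1) by (intro h.S.cgenideal_ideal) simp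
        fix p assume "blank d e C A p"
        then have "mat_unit R d e p \<in> ?M" using Ag assms(6) by (intro mat_unit_in_Rel)
        then have "map_mat d e h (mat_unit R d e p) \<in> ?N" by (rule imageI)
        then show "mat_unit S d e p \<in> ?N" unfolding h.map_mat_unit .
      next
        fix c p p' assume c: "c \<in> C" "p \<in> A c" "p' \<in> A c" "p \<noteq> p'"
        then have pg: "p \<in> grid d e" "p' \<in> grid d e" using Ag by blast+
        then have U: "u p \<in> Units R" "u p' \<in> Units R" using assms(7) by auto
        then have uc: "u p \<in> carrier R" "u p' \<in> carrier R" by auto
        \<comment> \<open>-1 is its own inverse, and -u_p is its product with a unit.\<close>
        have mU: "\<ominus>\<^bsub>R\<^esub> u p \<in> Units R"
        proof -
          have "\<ominus>\<^bsub>R\<^esub> \<one>\<^bsub>R\<^esub> \<in> Units R" unfolding Units_def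
            by (auto simp: l_minus r_minus intro!: bexI[of _ "\<ominus>\<^bsub>R\<^esub> \<one>\<^bsub>R\<^esub>"])
          then have "\<ominus>\<^bsub>R\<^esub> \<one>\<^bsub>R\<^esub> \<otimes>\<^bsub>R\<^esub> u p \<in> Units R" using U(1) by (rule Units_m_closed)
          then show ?thesis using uc by (simp add: l_minus)
        qed
        have "map_mat d e h (mat_lin R d e (mat_scale R d e (u p') (mat_unit R d e p)) (\<ominus>\<^bsub>R\<^esub> u p) (mat_unit R d e p')) \<in> ?N"
          using mat_unit_pair_in_Rel[OF assms(5,6) c] by (rule imageI)
        \<comment> \<open>Reduction carries the matrix of the pair to one of the same shape. Its
          second scalar is kept as the image of -u_p, a unit because homomorphisms preserve
          units.\<close>
        then have "mat_lin S d e (mat_scale S d e (h (u p')) (mat_unit S d e p)) (h (\<ominus>\<^bsub>R\<^esub> u p)) (mat_unit S d e p') \<in> ?N"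
          using uc by (simp add: h.map_mat_lin h.map_mat_scale h.map_mat_unit mat_unit_closed mat_scale_closed del: h.hom_a_inv)
        then show "\<exists>\<alpha>\<in>Units S. \<exists>\<beta>\<in>Units S. mat_lin S d e (mat_scale S d e \<alpha> (mat_unit S d e p)) \<beta> (mat_unit S d e p') \<in> ?N"
          using h.hom_Units[OF U(2)] h.hom_Units[OF mU] by (intro bexI)
      qed
    qed
    then show ?thesis unfolding matrices_mod_eq S_def h_def I_def .
  qed
  then show ?thesis
    unfolding ask_zeta_def by (rule ask_zeta_fps[rotated]) (use q in simp)
qed

end
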